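(* The double copresheaf 2-monad $\mathbb{P}^{\dag}\mathbb{P}=(\mathsf{P}^{\dag}\mathsf{P},\mathfrak{y}^{\dag},\mathfrak{s}^{\dag})$ on $\mathcal{Q}\text{-}\mathbf{Cat}$ distributes flatly over the presheaf 2-monad $\mathbb{P}$ by $\Lambda^{\dag}$ with $$\Lambda^{\dag}_X=\overleftarrow{((\mathsf{y}_X)_{!\,\text{!`}})_*}=((\mathsf{y}_X)_{!\,\text{!`}})^!\cdot\mathsf{y}_{\mathsf{P}^{\dag}\mathsf{P}\mathsf{P}X}=\mathsf{y}_X^{!\,\text{!`}\,!}\cdot\mathsf{y}_{\mathsf{P}^{\dag}\mathsf{P}\mathsf{P}X}:\mathsf{P}^{\dag}\mathsf{P}\mathsf{P}X\to\mathsf{P}\mathsf{P}^{\dag}\mathsf{P}X ;$$ that is, the family $(\Lambda^{\dag}_X)_X$, $X$ ranging over all $\mathcal{Q}$-categories, is a flat distributive law of $\mathbb{P}^{\dag}\mathbb{P}$ over $\mathbb{P}$.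
   Context: Basic conventions. $\mathcal{Q}$ is a small quantaloid: a small category whose hom-sets are complete lattices (order $\preceq$) and whose composition preserves arbitrary suprema in each variable; $\mathcal{Q}_0$ is its object set. For $u:r\to s$, $v:s\to t$, $w:r\to t$ in $\mathcal{Q}$, the arrows $v\searrow w:r\to s$ and $w\swarrow u:s\to t$ are defined by $u\preceq v\searrow w\iff v\circ u\preceq w\iff v\preceq w\swarrow u$. For sets $X,Y$ equipped with type maps $|\text{-}|$ to $\mathcal{Q}_0$, a $\mathcal{Q}$-relation $\phi:X\nrightarrow Y$ assigns to each $(x,y)$ a morphism $\phi(x,y):|x|\to|y|$ of $\mathcal{Q}$; these are ordered pointwise by $\preceq$ and composed by $(\psi\circ\phi)(x,z)=\bigvee_y\psi(y,z)\circ\phi(x,y)$. A $\mathcal{Q}$-category is a set $X$ over $\mathcal{Q}_0$ with a $\mathcal{Q}$-relation $1_X^*:X\nrightarrow X$ (its hom) such that $1_{|x|}\preceq 1_X^*(x,x)$ and $1_X^*\circ 1_X^*\preceq 1_X^*$; it is preordered by $x\leq x'\iff |x|=|x'|$ and $1_{|x|}\preceq 1_X^*(x,x')$. A $\mathcal{Q}$-functor $f:X\to Y$ is a type-preserving map with $1_X^*(x,x')\preceq 1_Y^*(fx,fx')$; $f\leq g$ is pointwise. This gives the locally preordered 2-category $\mathcal{Q}\text{-}\mathbf{Cat}$. A 2-functor on it is a functor that is monotone on homs; a 2-monad $(T,m,e)$ is a monad whose functor $T$ is a 2-functor (multiplication $m:TT\to T$, unit $e:1\to T$). A distributor $\phi:X\nrightarrow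 Y$ is a $\mathcal{Q}$-relation with $1_Y^*\circ\phi\circ 1_X^*\preceq\phi$. For a $\mathcal{Q}$-functor $f:X\to Y$: $f_*:X\nrightarrow Y$, $f_*(x,y)=1_Y^*(fx,y)$, and $f^*:Y\nrightarrow X$, $f^*(y,x)=1_Y^*(y,fx)$. Let $\{s\}$ be the one-object $\mathcal{Q}$-category of type $s\in\mathcal{Q}_0$ with hom $1_s$. $\mathsf{P}X$ is the $\mathcal{Q}$-category of distributors $\sigma:X\nrightarrow\{s\}$ ($|\sigma|=s$) with $1_{\mathsf{P}X}^*(\sigma,\sigma')=\bigwedge_x\sigma'(x)\swarrow\sigma(x)$; $\mathsf{P}^{\dag}X$ is the $\mathcal{Q}$-category of distributors $\tau:\{s\}\nrightarrow X$ ($|\tau|=s$) with $1_{\mathsf{P}^{\dag}X}^*(\tau,\tau')=\bigwedge_x\tau'(x)\searrow\tau(x)$ (so $\tau\leq\tau'$ in $\mathsf{P}^{\dag}X$ iff $\tau'\preceq\tau$). Yoneda embeddings: $\mathsf{y}_X:X\to\mathsf{P}X$, $x\mapsto 1_X^*(-,x)$; $\mathsf{y}^{\dag}_X:X\to\mathsf{P}^{\dag}X$, $x\mapsto 1_X^*(x,-)$. For $f:X\to Y$: $f_!:\mathsf{P}X\to\mathsf{P}Y$, $\sigma\mapsto\sigma\circ f^*$; $f^!:\mathsf{P}Y\to\mathsf{P}X$, $\sigma\mapsto\sigma\circ f_*$; $f_{\text{!`}}:\mathsf{P}^{\dag}X\to\mathsf{P}^{\dag}Y$, $\tau\mapsto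 f_*\circ\tau$; $f^{\text{!`}}:\mathsf{P}^{\dag}Y\to\mathsf{P}^{\dag}X$, $\tau\mapsto f^*\circ\tau$; iterated decorations are applied from left to right, e.g. $f_{!\,\text{!`}}=(f_!)_{\text{!`}}$ and $f^{!\,\text{!`}\,!}=((f^!)^{\text{!`}})^!$. For a distributor $\phi:X\nrightarrow Y$, $\overleftarrow{\phi}:Y\to\mathsf{P}X$ is $y\mapsto\phi(-,y)$. The presheaf 2-monad $\mathbb{P}=(\mathsf{P},\mathsf{s},\mathsf{y})$ sends $f$ to $f_!$, with unit $\mathsf{y}$ and multiplication $\mathsf{s}_X=\mathsf{y}_X^!:\mathsf{P}\mathsf{P}X\to\mathsf{P}X$. The double copresheaf 2-monad $\mathbb{P}^{\dag}\mathbb{P}$ has underlying 2-functor $X\mapsto\mathsf{P}^{\dag}\mathsf{P}X$, $f\mapsto f_{!\,\text{!`}}$, unit $\mathfrak{y}^{\dag}_X=\mathsf{y}^{\dag}_{\mathsf{P}X}\cdot\mathsf{y}_X:X\to\mathsf{P}^{\dag}\mathsf{P}X$ and multiplication $\mathfrak{s}^{\dag}_X=(\mathsf{y}_{\mathsf{P}^{\dag}\mathsf{P}X}\cdot\mathsf{y}^{\dag}_{\mathsf{P}X})^{\text{!`}}:\mathsf{P}^{\dag}\mathsf{P}\mathsf{P}^{\dag}\mathsf{P}X\to\mathsf{P}^{\dag}\mathsf{P}X$. Distributive laws ("distributive law" means lax distributive law). For a 2-monad $\mathbb{T}=(T,m,e)$ on $\mathcal{Q}\text{-}\mathbf{Cat}$,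 a distributive law $\lambda:T\mathsf{P}\to\mathsf{P}T$ of $\mathbb{T}$ over $\mathbb{P}$ is a family of $\mathcal{Q}$-functors $\lambda_X:T\mathsf{P}X\to\mathsf{P}TX$ such that for all $\mathcal{Q}$-functors $f:X\to Y$: (a) $(Tf)_!\cdot\lambda_X\leq\lambda_Y\cdot T(f_!)$; (b) $\mathsf{y}_{TX}\leq\lambda_X\cdot T\mathsf{y}_X$; (c) $\mathsf{s}_{TX}\cdot(\lambda_X)_!\cdot\lambda_{\mathsf{P}X}\leq\lambda_X\cdot T\mathsf{s}_X$; (d) $(e_X)_!\leq\lambda_X\cdot e_{\mathsf{P}X}$; (e) $(m_X)_!\cdot\lambda_{TX}\cdot T\lambda_X\leq\lambda_X\cdot m_{\mathsf{P}X}$. It is flat if (b) is an equality for all $X$. "$\mathbb{T}$ distributes flatly over $\mathbb{P}$ by $\lambda$" means that $\lambda$ is a flat distributive law. *)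

theory Defs
  imports "HOL-Algebra.Complete_Lattice" "HOL-Library.FuncSet"
begin

section \<open>Quantaloids\<close>

record ('o, 'm) quantaloid_data =
  obj :: "'o set"
  arr :: "'m set"
  src :: "'m \<Rightarrow> 'o"
  tgt :: "'m \<Rightarrow> 'o"
  ident :: "'o \<Rightarrow> 'm"
  cmp :: "'m \<Rightarrow> 'm \<Rightarrow> 'm"  (infixl \<open>\<odot>\<index>\<close> 70)
  leq :: "'m \<Rightarrow> 'm \<Rightarrow> bool"  (infix \<open>\<preceq>\<index>\<close> 50)

text \<open>The hom-set from \<open>r\<close> to \<open>s\<close> as an ordered structure. The relation \<open>leq\<close> is only meaningful
  on parallel arrows, and suprema and infima are always taken in a specified hom-lattice (which
  matters for the empty family).\<close>

definition homl :: "('o, 'm) quantaloid_data \<Rightarrow> 'o \<Rightarrow> 'o \<Rightarrow> 'm gorder" where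
  "homl Q r s = \<lparr>carrier = {u \<in> arr Q. src Q u = r \<and> tgt Q u = s}, eq = (=), le = leq Q\<rparr>"

abbreviation homs :: "('o, 'm) quantaloid_data \<Rightarrow> 'o \<Rightarrow> 'o \<Rightarrow> 'm set" where
  "homs Q r s \<equiv> carrier (homl Q r s)"

locale quantaloid = fixes Q :: "('o, 'm) quantaloid_data" (structure)
  assumes src_tgt: "u \<in> arr Q \<Longrightarrow> src Q u \<in> obj Q \<and> tgt Q u \<in> obj Q"
    and ident_in: "r \<in> obj Q \<Longrightarrow> ident Q r \<in> homs Q r r"
    and cmp_in: "\<lbrakk>u \<in> homs Q r s; v \<in> homs Q s t\<rbrakk> \<Longrightarrow> v \<odot> u \<in> homs Q r t"
    and cmp_ident: "u \<in> homs Q r s \<Longrightarrow> u \<odot> ident Q r = u \<and> ident Q s \<odot> u = u"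
    and cmp_assoc: "\<lbrakk>u \<in> homs Q q r; v \<in> homs Q r s; w \<in> homs Q s t\<rbrakk>
      \<Longrightarrow> (w \<odot> v) \<odot> u = w \<odot> (v \<odot> u)"
    and hom_complete: "\<lbrakk>r \<in> obj Q; s \<in> obj Q\<rbrakk> \<Longrightarrow> complete_lattice (homl Q r s)"
    and cmp_sup_left: "\<lbrakk>u \<in> homs Q r s; t \<in> obj Q; V \<subseteq> homs Q s t\<rbrakk>
      \<Longrightarrow> (\<Squnion>\<^bsub>homl Q s t\<^esub> V) \<odot> u = \<Squnion>\<^bsub>homl Q r t\<^esub> ((\<lambda>v. v \<odot> u) ` V)"
    and cmp_sup_right: "\<lbrakk>v \<in> homs Q s t; r \<in> obj Q; U \<subseteq> homs Q r s\<rbrakk>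
      \<Longrightarrow> v \<odot> (\<Squnion>\<^bsub>homl Q r s\<^esub> U) = \<Squnion>\<^bsub>homl Q r t\<^esub> ((\<lambda>u. v \<odot> u) ` U)"

text \<open>\<open>rres Q v w\<close> is $v \searrow w$ (for arrows with a common target) and \<open>lres Q w u\<close> is
  $w \swarrow u$ (for arrows with a common source).\<close>

definition rres :: "('o, 'm) quantaloid_data \<Rightarrow> 'm \<Rightarrow> 'm \<Rightarrow> 'm" where
  "rres Q v w = (THE d. d \<in> homs Q (src Q w) (src Q v) \<and>
     (\<forall>u \<in> homs Q (src Q w) (src Q v). u \<preceq>\<^bsub>Q\<^esub> d \<longleftrightarrow> v \<odot>\<^bsub>Q\<^esub> u \<preceq>\<^bsub>Q\<^esub> w))"

definition lres :: "('o, 'm) quantaloid_data \<Rightarrow> 'm \<Rightarrow> 'm \<Rightarrow> 'm" where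
  "lres Q w u = (THE d. d \<in> homs Q (tgt Q u) (tgt Q w) \<and>
     (\<forall>v \<in> homs Q (tgt Q u) (tgt Q w). v \<preceq>\<^bsub>Q\<^esub> d \<longleftrightarrow> v \<odot>\<^bsub>Q\<^esub> u \<preceq>\<^bsub>Q\<^esub> w))"


section \<open>Categories, functors and distributors enriched in a quantaloid\<close>

record ('a, 'o, 'm) qcat_data =
  qob :: "'a set"
  qtype :: "'a \<Rightarrow> 'o"
  qhom :: "'a \<Rightarrow> 'a \<Rightarrow> 'm"

text \<open>Relations between the underlying typed sets; \<open>qhom\<close> plays no role in the next three
  definitions.\<close>

definition qrel :: "('o, 'm) quantaloid_data \<Rightarrow> ('a, 'o, 'm) qcat_data \<Rightarrow> ('b, 'o, 'm) qcat_data
    \<Rightarrow> ('a \<Rightarrow> 'b \<Rightarrow> 'm) \<Rightarrow> bool" where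
  "qrel Q X Y \<phi> \<longleftrightarrow> (\<forall>x \<in> qob X. \<forall>y \<in> qob Y. \<phi> x y \<in> homs Q (qtype X x) (qtype Y y))"

definition qrel_le :: "('o, 'm) quantaloid_data \<Rightarrow> ('a, 'o, 'm) qcat_data
    \<Rightarrow> ('b, 'o, 'm) qcat_data \<Rightarrow> ('a \<Rightarrow> 'b \<Rightarrow> 'm) \<Rightarrow> ('a \<Rightarrow> 'b \<Rightarrow> 'm) \<Rightarrow> bool" where
  "qrel_le Q X Y \<phi> \<psi> \<longleftrightarrow> (\<forall>x \<in> qob X. \<forall>y \<in> qob Y. \<phi> x y \<preceq>\<^bsub>Q\<^esub> \<psi> x y)"

definition rcomp :: "('o, 'm) quantaloid_data \<Rightarrow> ('a, 'o, 'm) qcat_data \<Rightarrow> ('b, 'o, 'm) qcat_data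
    \<Rightarrow> ('c, 'o, 'm) qcat_data \<Rightarrow> ('b \<Rightarrow> 'c \<Rightarrow> 'm) \<Rightarrow> ('a \<Rightarrow> 'b \<Rightarrow> 'm) \<Rightarrow> 'a \<Rightarrow> 'c \<Rightarrow> 'm" where
  "rcomp Q X Y Z \<psi> \<phi> x z = \<Squnion>\<^bsub>homl Q (qtype X x) (qtype Z z)\<^esub> ((\<lambda>y. \<psi> y z \<odot>\<^bsub>Q\<^esub> \<phi> x y) ` qob Y)"

definition qcategory :: "('o, 'm) quantaloid_data \<Rightarrow> ('a, 'o, 'm) qcat_data \<Rightarrow> bool" where
  "qcategory Q X \<longleftrightarrow>
     qtype X \<in> qob X \<rightarrow> obj Q \<and>
     qrel Q X X (qhom X) \<and>
     (\<forall>x \<in> qob X. ident Q (qtype X x) \<preceq>\<^bsub>Q\<^esub> qhom X x x) \<and>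
     qrel_le Q X X (rcomp Q X X X (qhom X) (qhom X)) (qhom X)"

definition qle :: "('o, 'm) quantaloid_data \<Rightarrow> ('a, 'o, 'm) qcat_data \<Rightarrow> 'a \<Rightarrow> 'a \<Rightarrow> bool" where
  "qle Q X x x' \<longleftrightarrow> qtype X x = qtype X x' \<and> ident Q (qtype X x) \<preceq>\<^bsub>Q\<^esub> qhom X x x'"

text \<open>A functor is a function on the whole type of which only the values on \<open>qob X\<close> matter.\<close>

definition qfunctor :: "('o, 'm) quantaloid_data \<Rightarrow> ('a, 'o, 'm) qcat_data
    \<Rightarrow> ('b, 'o, 'm) qcat_data \<Rightarrow> ('a \<Rightarrow> 'b) \<Rightarrow> bool" where
  "qfunctor Q X Y f \<longleftrightarrow>
     f \<in> qob X \<rightarrow> qob Y \<and>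
     (\<forall>x \<in> qob X. qtype Y (f x) = qtype X x) \<and>
     (\<forall>x \<in> qob X. \<forall>x' \<in> qob X. qhom X x x' \<preceq>\<^bsub>Q\<^esub> qhom Y (f x) (f x'))"

definition qfun_le :: "('o, 'm) quantaloid_data \<Rightarrow> ('a, 'o, 'm) qcat_data
    \<Rightarrow> ('b, 'o, 'm) qcat_data \<Rightarrow> ('a \<Rightarrow> 'b) \<Rightarrow> ('a \<Rightarrow> 'b) \<Rightarrow> bool" where
  "qfun_le Q X Y f g \<longleftrightarrow> (\<forall>x \<in> qob X. qle Q Y (f x) (g x))"

definition qdist :: "('o, 'm) quantaloid_data \<Rightarrow> ('a, 'o, 'm) qcat_data \<Rightarrow> ('b, 'o, 'm) qcat_data
    \<Rightarrow> ('a \<Rightarrow> 'b \<Rightarrow> 'm) \<Rightarrow> bool" where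
  "qdist Q X Y \<phi> \<longleftrightarrow>
     qrel Q X Y \<phi> \<and>
     qrel_le Q X Y (rcomp Q X Y Y (qhom Y) (rcomp Q X X Y \<phi> (qhom X))) \<phi>"

text \<open>\<open>lgraph Y f\<close> is $f_*$ and \<open>ugraph Y f\<close> is $f^*$, for a functor \<open>f\<close> into \<open>Y\<close>.\<close>

definition lgraph :: "('b, 'o, 'm) qcat_data \<Rightarrow> ('a \<Rightarrow> 'b) \<Rightarrow> 'a \<Rightarrow> 'b \<Rightarrow> 'm" where
  "lgraph Y f x y = qhom Y (f x) y"

definition ugraph :: "('b, 'o, 'm) qcat_data \<Rightarrow> ('a \<Rightarrow> 'b) \<Rightarrow> 'b \<Rightarrow> 'a \<Rightarrow> 'm" where
  "ugraph Y f y x = qhom Y y (f x)"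


section \<open>Presheaves and copresheaves\<close>

definition point :: "('o, 'm) quantaloid_data \<Rightarrow> 'o \<Rightarrow> ('o, 'o, 'm) qcat_data" where
  "point Q s = \<lparr>qob = {s}, qtype = (\<lambda>_. s), qhom = (\<lambda>_ _. ident Q s)\<rparr>"

text \<open>A presheaf is a pair of its type \<open>s\<close> and the function \<open>\<sigma>\<close> of the remaining argument; \<open>\<sigma>\<close> is
  taken extensional so that equal presheaves are equal as terms, and \<open>s\<close> is recorded because it
  is not determined by \<open>\<sigma>\<close> when \<open>X\<close> is empty. Dually for copresheaves.\<close>

definition Psh :: "('o, 'm) quantaloid_data \<Rightarrow> ('a, 'o, 'm) qcat_data
    \<Rightarrow> ('o \<times> ('a \<Rightarrow> 'm), 'o, 'm) qcat_data" where
  "Psh Q X =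
     \<lparr>qob = {(s, \<sigma>). s \<in> obj Q \<and> \<sigma> \<in> extensional (qob X) \<and> qdist Q X (point Q s) (\<lambda>x _. \<sigma> x)},
      qtype = fst,
      qhom = (\<lambda>(s, \<sigma>) (s', \<sigma>'). \<Sqinter>\<^bsub>homl Q s s'\<^esub> ((\<lambda>x. lres Q (\<sigma>' x) (\<sigma> x)) ` qob X))\<rparr>"

definition Copsh :: "('o, 'm) quantaloid_data \<Rightarrow> ('a, 'o, 'm) qcat_data
    \<Rightarrow> ('o \<times> ('a \<Rightarrow> 'm), 'o, 'm) qcat_data" where
  "Copsh Q X =
     \<lparr>qob = {(s, \<tau>). s \<in> obj Q \<and> \<tau> \<in> extensional (qob X) \<and> qdist Q (point Q s) X (\<lambda>_ x. \<tau> x)},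
      qtype = fst,
      qhom = (\<lambda>(s, \<tau>) (s', \<tau>'). \<Sqinter>\<^bsub>homl Q s s'\<^esub> ((\<lambda>x. rres Q (\<tau>' x) (\<tau> x)) ` qob X))\<rparr>"

definition yon :: "('a, 'o, 'm) qcat_data \<Rightarrow> 'a \<Rightarrow> 'o \<times> ('a \<Rightarrow> 'm)" where
  "yon X x = (qtype X x, \<lambda>x' \<in> qob X. qhom X x' x)"

definition coyon :: "('a, 'o, 'm) qcat_data \<Rightarrow> 'a \<Rightarrow> 'o \<times> ('a \<Rightarrow> 'm)" where
  "coyon X x = (qtype X x, \<lambda>x' \<in> qob X. qhom X x x')"

text \<open>For \<open>f\<close> from \<open>X\<close> to \<open>Y\<close>: \<open>psh_l\<close>, \<open>psh_u\<close>, \<open>cop_l\<close>, \<open>cop_u\<close> are the decorations of \<open>f\<close> with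
  a lower exclamation mark, an upper one, a lower inverted one and an upper inverted one.\<close>

definition psh_l :: "('o, 'm) quantaloid_data \<Rightarrow> ('a, 'o, 'm) qcat_data \<Rightarrow> ('b, 'o, 'm) qcat_data
    \<Rightarrow> ('a \<Rightarrow> 'b) \<Rightarrow> 'o \<times> ('a \<Rightarrow> 'm) \<Rightarrow> 'o \<times> ('b \<Rightarrow> 'm)" where
  "psh_l Q X Y f = (\<lambda>(s, \<sigma>).
     (s, \<lambda>y \<in> qob Y. rcomp Q Y X (point Q s) (\<lambda>x _. \<sigma> x) (ugraph Y f) y s))"

definition psh_u :: "('o, 'm) quantaloid_data \<Rightarrow> ('a, 'o, 'm) qcat_data \<Rightarrow> ('b, 'o, 'm) qcat_data
    \<Rightarrow> ('a \<Rightarrow> 'b) \<Rightarrow> 'o \<times> ('b \<Rightarrow> 'm) \<Rightarrow> 'o \<times> ('a \<Rightarrow> 'm)" where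
  "psh_u Q X Y f = (\<lambda>(s, \<sigma>).
     (s, \<lambda>x \<in> qob X. rcomp Q X Y (point Q s) (\<lambda>y _. \<sigma> y) (lgraph Y f) x s))"

definition cop_l :: "('o, 'm) quantaloid_data \<Rightarrow> ('a, 'o, 'm) qcat_data \<Rightarrow> ('b, 'o, 'm) qcat_data
    \<Rightarrow> ('a \<Rightarrow> 'b) \<Rightarrow> 'o \<times> ('a \<Rightarrow> 'm) \<Rightarrow> 'o \<times> ('b \<Rightarrow> 'm)" where
  "cop_l Q X Y f = (\<lambda>(s, \<tau>).
     (s, \<lambda>y \<in> qob Y. rcomp Q (point Q s) X Y (lgraph Y f) (\<lambda>_ x. \<tau> x) s y))"

definition cop_u :: "('o, 'm) quantaloid_data \<Rightarrow> ('a, 'o, 'm) qcat_data \<Rightarrow> ('b, 'o, 'm) qcat_data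
    \<Rightarrow> ('a \<Rightarrow> 'b) \<Rightarrow> 'o \<times> ('b \<Rightarrow> 'm) \<Rightarrow> 'o \<times> ('a \<Rightarrow> 'm)" where
  "cop_u Q X Y f = (\<lambda>(s, \<tau>).
     (s, \<lambda>x \<in> qob X. rcomp Q (point Q s) Y X (ugraph Y f) (\<lambda>_ y. \<tau> y) s x))"

text \<open>The functor $\overleftarrow{\phi}$ from \<open>Y\<close> to \<open>Psh Q X\<close> given by a distributor \<open>\<phi>\<close> from \<open>X\<close>
  to \<open>Y\<close>.\<close>

definition larrow :: "('a, 'o, 'm) qcat_data \<Rightarrow> ('b, 'o, 'm) qcat_data \<Rightarrow> ('a \<Rightarrow> 'b \<Rightarrow> 'm)
    \<Rightarrow> 'b \<Rightarrow> 'o \<times> ('a \<Rightarrow> 'm)" where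
  "larrow X Y \<phi> y = (qtype Y y, \<lambda>x \<in> qob X. \<phi> x y)"


section \<open>The presheaf monad, the double copresheaf monad and the law\<close>

definition psh_mult :: "('o, 'm) quantaloid_data \<Rightarrow> ('a, 'o, 'm) qcat_data
    \<Rightarrow> 'o \<times> ('o \<times> ('a \<Rightarrow> 'm) \<Rightarrow> 'm) \<Rightarrow> 'o \<times> ('a \<Rightarrow> 'm)" where
  "psh_mult Q X = psh_u Q X (Psh Q X) (yon X)"

definition DC :: "('o, 'm) quantaloid_data \<Rightarrow> ('a, 'o, 'm) qcat_data
    \<Rightarrow> ('o \<times> ('o \<times> ('a \<Rightarrow> 'm) \<Rightarrow> 'm), 'o, 'm) qcat_data" where
  "DC Q X = Copsh Q (Psh Q X)"

definition dc_map :: "('o, 'm) quantaloid_data \<Rightarrow> ('a, 'o, 'm) qcat_data \<Rightarrow> ('b, 'o, 'm) qcat_data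
    \<Rightarrow> ('a \<Rightarrow> 'b) \<Rightarrow> 'o \<times> ('o \<times> ('a \<Rightarrow> 'm) \<Rightarrow> 'm) \<Rightarrow> 'o \<times> ('o \<times> ('b \<Rightarrow> 'm) \<Rightarrow> 'm)" where
  "dc_map Q X Y f = cop_l Q (Psh Q X) (Psh Q Y) (psh_l Q X Y f)"

definition dc_unit :: "('o, 'm) quantaloid_data \<Rightarrow> ('a, 'o, 'm) qcat_data
    \<Rightarrow> 'a \<Rightarrow> 'o \<times> ('o \<times> ('a \<Rightarrow> 'm) \<Rightarrow> 'm)" where
  "dc_unit Q X = coyon (Psh Q X) \<circ> yon X"

definition dc_mult :: "('o, 'm) quantaloid_data \<Rightarrow> ('a, 'o, 'm) qcat_data
    \<Rightarrow> 'o \<times> ('o \<times> ('o \<times> ('o \<times> ('a \<Rightarrow> 'm) \<Rightarrow> 'm) \<Rightarrow> 'm) \<Rightarrow> 'm)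
    \<Rightarrow> 'o \<times> ('o \<times> ('a \<Rightarrow> 'm) \<Rightarrow> 'm)" where
  "dc_mult Q X = cop_u Q (Psh Q X) (Psh Q (DC Q X)) (yon (DC Q X) \<circ> coyon (Psh Q X))"

definition dc_law :: "('o, 'm) quantaloid_data \<Rightarrow> ('a, 'o, 'm) qcat_data
    \<Rightarrow> 'o \<times> ('o \<times> ('o \<times> ('a \<Rightarrow> 'm) \<Rightarrow> 'm) \<Rightarrow> 'm)
    \<Rightarrow> 'o \<times> ('o \<times> ('o \<times> ('a \<Rightarrow> 'm) \<Rightarrow> 'm) \<Rightarrow> 'm)" where
  "dc_law Q X = larrow (DC Q X) (DC Q (Psh Q X))
     (lgraph (DC Q (Psh Q X)) (dc_map Q X (Psh Q X) (yon X)))"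

end

theory Submission
  imports Defs
begin

text \<open>
  Write \<open>P\<close> for the presheaf monad, with unit \<open>y\<close> and multiplication \<open>s\<close>, and \<open>D\<close> for the
  double copresheaf functor. Two observations make the theorem almost formal.

  First, every decoration with an upper mark is precomposition: by the action of homs the
  supremum defining \<open>f\<^sup>!\<close> reduces to \<open>p \<mapsto> p \<circ> f\<close>, and dually for copresheaves (\<open>psh_u_eq\<close>, \<open>cop_u_eq\<close>).
  As \<open>f\<^sub>!\<close> is left adjoint to \<open>f\<^sup>!\<close> (\<open>psh_adjunction\<close>), the functor \<open>D f\<close>, although
  defined with lower marks, is precomposition with \<open>f\<^sup>!\<close> (\<open>dc_map_eq_cop_u\<close>). So \<open>D\<close> is
  functorial on the nose, and unit, multiplication and \<open>D y\<close> are evaluations without suprema.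

  Second, the value of the law at \<open>S \<in> D (P X)\<close> is the presheaf \<open>t \<mapsto> D (P X) (D y t, S)\<close>, where
  the hom of \<open>D (P X)\<close> is meant. Every inequality whose smaller side is the image of a presheaf
  under some \<open>f\<^sub>!\<close> is moved across the adjunction and becomes a comparison of homs.
  Naturality follows from the functoriality of \<open>D\<close> and
  \<open>f\<^sub>! \<circ> y = y \<circ> f\<close>; flatness says that \<open>D y\<close> is fully faithful, which holds because
  \<open>s \<circ> y = id\<close>; compatibility with \<open>s\<close> holds because \<open>D s \<circ> D y = id\<close>; compatibility with the
  unit is naturality of the unit together with the Yoneda lemma.

  Only compatibility with the multiplication of \<open>D\<close> needs an idea. It compares a hom of copresheaves
  on \<open>P P D X\<close> with one of copresheaves on \<open>P P X\<close>. For each \<open>S \<in> P P X\<close>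
  the former is tested on the representable presheaf of the law applied to the corepresentable
  copresheaf of \<open>S\<close>. The law sends this corepresentable to the representable of the corepresentable
  of \<open>s S\<close> (\<open>dc_law_coyon\<close>), and with that both sides match (\<open>dc_law_mult\<close>).
\<close>


section \<open>Hom-lattices and residuation\<close>

context quantaloid
begin

lemma homsD: "u \<in> homs Q r s \<Longrightarrow> r \<in> obj Q \<and> s \<in> obj Q \<and> src Q u = r \<and> tgt Q u = s"
  using src_tgt by (auto simp: homl_def)

lemma hom_refl: "u \<in> homs Q r s \<Longrightarrow> u \<preceq> u"
  and hom_trans: "\<lbrakk>u \<preceq> v; v \<preceq> w; u \<in> homs Q r s; v \<in> homs Q r s; w \<in> homs Q r s\<rbrakk> \<Longrightarrow> u \<preceq> w"
  and hom_antisym: "\<lbrakk>u \<preceq> v; v \<preceq> u; u \<in> homs Q r s; v \<in> homs Q r s\<rbrakk> \<Longrightarrow> u = v"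
proof -
  have L: "complete_lattice (homl Q r s)" if "x \<in> homs Q r s" for x
    using homsD[OF that] hom_complete by blast
  have le: "le (homl Q r s) = leq Q"
    by (simp add: homl_def)
  show "u \<preceq> u" if "u \<in> homs Q r s"
  proof -
    interpret complete_lattice "homl Q r s" using L that .
    show ?thesis using le_refl[OF that] by (simp add: le)
  qed
  show "u \<preceq> w" if "u \<preceq> v" "v \<preceq> w" "u \<in> homs Q r s" "v \<in> homs Q r s" "w \<in> homs Q r s"
  proof -
    interpret complete_lattice "homl Q r s" using L that(3) .
    show ?thesis using le_trans[of u v w] that by (simp add: le)
  qed
  show "u = v" if "u \<preceq> v" "v \<preceq> u" "u \<in> homs Q r s" "v \<in> homs Q r s"
  proof -
    interpret complete_lattice "homl Q r s" using L that(3) .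
    show ?thesis using le_antisym[of u v] that by (simp add: le)
  qed
qed

context
  fixes r s U
  assumes rs: "r \<in> obj Q" "s \<in> obj Q" and U: "U \<subseteq> homs Q r s"
begin

interpretation complete_lattice "homl Q r s"
  using hom_complete rs .

lemma Sup_in: "\<Squnion>\<^bsub>homl Q r s\<^esub> U \<in> homs Q r s"
  and Inf_in: "\<Sqinter>\<^bsub>homl Q r s\<^esub> U \<in> homs Q r s"
  using U by simp_all

lemma le_Sup: "u \<in> U \<Longrightarrow> u \<preceq> \<Squnion>\<^bsub>homl Q r s\<^esub> U"
  using sup_upper[OF U] by (simp add: homl_def)

lemma Inf_le: "u \<in> U \<Longrightarrow> \<Sqinter>\<^bsub>homl Q r s\<^esub> U \<preceq> u"
  using inf_lower[OF U] by (simp add: homl_def)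

lemma Sup_le_iff: "w \<in> homs Q r s \<Longrightarrow> \<Squnion>\<^bsub>homl Q r s\<^esub> U \<preceq> w \<longleftrightarrow> (\<forall>u \<in> U. u \<preceq> w)"
proof
  show "\<forall>u \<in> U. u \<preceq> w" if "w \<in> homs Q r s" "\<Squnion>\<^bsub>homl Q r s\<^esub> U \<preceq> w"
    using hom_trans[OF le_Sup that(2)] that(1) Sup_in U by blast
  show "\<Squnion>\<^bsub>homl Q r s\<^esub> U \<preceq> w" if "w \<in> homs Q r s" "\<forall>u \<in> U. u \<preceq> w"
    using sup_least[OF U that(1)] that(2) by (simp add: homl_def)
qed

lemma le_Inf_iff: "w \<in> homs Q r s \<Longrightarrow> w \<preceq> \<Sqinter>\<^bsub>homl Q r s\<^esub> U \<longleftrightarrow> (\<forall>u \<in> U. w \<preceq> u)"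
proof
  show "\<forall>u \<in> U. w \<preceq> u" if "w \<in> homs Q r s" "w \<preceq> \<Sqinter>\<^bsub>homl Q r s\<^esub> U"
    using hom_trans[OF that(2) Inf_le] that(1) Inf_in U by blast
  show "w \<preceq> \<Sqinter>\<^bsub>homl Q r s\<^esub> U" if "w \<in> homs Q r s" "\<forall>u \<in> U. w \<preceq> u"
    using inf_greatest[OF U that(1)] that(2) by (simp add: homl_def)
qed

end

lemma Sup_cmp_le_iff:
  assumes "V \<subseteq> homs Q s t" "u \<in> homs Q r s" "w \<in> homs Q r t" "t \<in> obj Q"
  shows "(\<Squnion>\<^bsub>homl Q s t\<^esub> V) \<odot> u \<preceq> w \<longleftrightarrow> (\<forall>v \<in> V. v \<odot> u \<preceq> w)"
proof -
  have "(\<lambda>v. v \<odot> u) ` V \<subseteq> homs Q r t"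
    using assms cmp_in by blast
  then show ?thesis
    using assms homsD[of u] homsD[of w] by (simp add: cmp_sup_left Sup_le_iff)
qed

lemma cmp_Sup_le_iff:
  assumes "U \<subseteq> homs Q r s" "v \<in> homs Q s t" "w \<in> homs Q r t" "r \<in> obj Q"
  shows "v \<odot> (\<Squnion>\<^bsub>homl Q r s\<^esub> U) \<preceq> w \<longleftrightarrow> (\<forall>u \<in> U. v \<odot> u \<preceq> w)"
proof -
  have "(\<lambda>u. v \<odot> u) ` U \<subseteq> homs Q r t"
    using assms cmp_in by blast
  then show ?thesis
    using assms homsD[of v] homsD[of w] by (simp add: cmp_sup_right Sup_le_iff)
qed

text \<open>Composition is only assumed to preserve suprema; monotonicity is the case of a two-element
  supremum.\<close>

lemma Sup_pair: "\<lbrakk>u \<preceq> v; u \<in> homs Q r s; v \<in> homs Q r s\<rbrakk> \<Longrightarrow> \<Squnion>\<^bsub>homl Q r s\<^esub> {u, v} = v"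
  using homsD[of u r s]
  by (intro hom_antisym[of _ _ r s]) (auto simp: Sup_le_iff hom_refl intro!: Sup_in le_Sup)

lemma cmp_mono_left:
  assumes "v \<preceq> v'" "v \<in> homs Q s t" "v' \<in> homs Q s t" "u \<in> homs Q r s"
  shows "v \<odot> u \<preceq> v' \<odot> u"
  using Sup_cmp_le_iff[of "{v, v'}" s t u r "v' \<odot> u"] assms homsD[of v] cmp_in[of u r s v' t]
  by (simp add: Sup_pair hom_refl)

lemma cmp_mono_right:
  assumes "u \<preceq> u'" "u \<in> homs Q r s" "u' \<in> homs Q r s" "v \<in> homs Q s t"
  shows "v \<odot> u \<preceq> v \<odot> u'"
  using cmp_Sup_le_iff[of "{u, u'}" r s v t "v \<odot> u'"] assms homsD[of u] cmp_in[of u' r s v t]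
  by (simp add: Sup_pair hom_refl)

text \<open>Both residuals exist because composition preserves suprema: the supremum of all arrows
  satisfying the defining inequality satisfies it too.\<close>

lemma rres:
  assumes v: "v \<in> homs Q s t" and w: "w \<in> homs Q r t"
  shows rres_in: "rres Q v w \<in> homs Q r s"
    and le_rres_iff: "u \<in> homs Q r s \<Longrightarrow> u \<preceq> rres Q v w \<longleftrightarrow> v \<odot> u \<preceq> w"
proof -
  have sv: "src Q v = s" "src Q w = r" and rs: "r \<in> obj Q" "s \<in> obj Q"
    using homsD[OF v] homsD[OF w] by auto
  let ?P = "\<lambda>d. d \<in> homs Q r s \<and> (\<forall>u \<in> homs Q r s. u \<preceq> d \<longleftrightarrow> v \<odot> u \<preceq> w)"
  let ?U = "{u \<in> homs Q r s. v \<odot> u \<preceq> w}"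
  let ?d = "\<Squnion>\<^bsub>homl Q r s\<^esub> ?U"
  have U: "?U \<subseteq> homs Q r s" by blast
  have d: "?d \<in> homs Q r s" using Sup_in[OF rs U] .
  have vd: "v \<odot> ?d \<preceq> w" using cmp_Sup_le_iff[OF U v w] rs by blast
  have "u \<preceq> ?d \<longleftrightarrow> v \<odot> u \<preceq> w" if u: "u \<in> homs Q r s" for u
  proof
    show "v \<odot> u \<preceq> w" if "u \<preceq> ?d"
      using hom_trans[OF cmp_mono_right[OF that u d v] vd] cmp_in v w u d by blast
    show "u \<preceq> ?d" if "v \<odot> u \<preceq> w"
      using le_Sup[OF rs U] u that by blast
  qed
  then have Pd: "?P ?d" using d by blast
  have "e = ?d" if "?P e" for e
    using that Pd hom_antisym[of e ?d r s] hom_refl by blast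
  then have "?P (rres Q v w)"
    unfolding rres_def sv using theI[of ?P, OF Pd] by blast
  then show "rres Q v w \<in> homs Q r s"
    and "u \<in> homs Q r s \<Longrightarrow> u \<preceq> rres Q v w \<longleftrightarrow> v \<odot> u \<preceq> w" by blast+
qed

lemma lres:
  assumes u: "u \<in> homs Q r s" and w: "w \<in> homs Q r t"
  shows lres_in: "lres Q w u \<in> homs Q s t"
    and le_lres_iff: "v \<in> homs Q s t \<Longrightarrow> v \<preceq> lres Q w u \<longleftrightarrow> v \<odot> u \<preceq> w"
proof -
  have su: "tgt Q u = s" "tgt Q w = t" and st: "s \<in> obj Q" "t \<in> obj Q"
    using homsD[OF u] homsD[OF w] by auto
  let ?P = "\<lambda>d. d \<in> homs Q s t \<and> (\<forall>v \<in> homs Q s t. v \<preceq> d \<longleftrightarrow> v \<odot> u \<preceq> w)"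
  let ?V = "{v \<in> homs Q s t. v \<odot> u \<preceq> w}"
  let ?d = "\<Squnion>\<^bsub>homl Q s t\<^esub> ?V"
  have V: "?V \<subseteq> homs Q s t" by blast
  have d: "?d \<in> homs Q s t" using Sup_in[OF st V] .
  have du: "?d \<odot> u \<preceq> w" using Sup_cmp_le_iff[OF V u w] st by blast
  have "v \<preceq> ?d \<longleftrightarrow> v \<odot> u \<preceq> w" if v: "v \<in> homs Q s t" for v
  proof
    show "v \<odot> u \<preceq> w" if "v \<preceq> ?d"
      using hom_trans[OF cmp_mono_left[OF that v d u] du] cmp_in v w u d by blast
    show "v \<preceq> ?d" if "v \<odot> u \<preceq> w"
      using le_Sup[OF st V] v that by blast
  qed
  then have Pd: "?P ?d" using d by blast
  have "e = ?d" if "?P e" for e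
    using that Pd hom_antisym[of e ?d s t] hom_refl by blast
  then have "?P (lres Q w u)"
    unfolding lres_def su using theI[of ?P, OF Pd] by blast
  then show "lres Q w u \<in> homs Q s t"
    and "v \<in> homs Q s t \<Longrightarrow> v \<preceq> lres Q w u \<longleftrightarrow> v \<odot> u \<preceq> w" by blast+
qed

lemma hom_eqI:
  assumes "a \<in> homs Q r s" "b \<in> homs Q r s" "\<And>u. u \<in> homs Q r s \<Longrightarrow> u \<preceq> a \<longleftrightarrow> u \<preceq> b"
  shows "a = b"
  using hom_antisym[OF _ _ assms(1,2)] assms(3)[OF assms(1)] assms(3)[OF assms(2)]
    hom_refl[OF assms(1)] hom_refl[OF assms(2)] by simp

lemma Sup_eqI:
  assumes U: "U \<subseteq> homs Q r s" and w: "w \<in> homs Q r s"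
    and "\<And>u. u \<in> U \<Longrightarrow> u \<preceq> w" and u: "u \<in> U" and "w \<preceq> u"
  shows "\<Squnion>\<^bsub>homl Q r s\<^esub> U = w"
proof (rule hom_antisym)
  have rs: "r \<in> obj Q" "s \<in> obj Q" using homsD[OF w] by auto
  show "\<Squnion>\<^bsub>homl Q r s\<^esub> U \<preceq> w" using Sup_le_iff[OF rs U w] assms(3) by blast
  show S: "\<Squnion>\<^bsub>homl Q r s\<^esub> U \<in> homs Q r s" using Sup_in[OF rs U] .
  show "w \<preceq> \<Squnion>\<^bsub>homl Q r s\<^esub> U"
    using hom_trans[OF \<open>w \<preceq> u\<close> le_Sup[OF rs U u] w _ S] U u by blast
qed (rule w)

lemma cmp_chain_left:
  assumes "h \<odot> u \<preceq> v" "h' \<odot> v \<preceq> w"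
    and u: "u \<in> homs Q q r" and h: "h \<in> homs Q r s" and h': "h' \<in> homs Q s t"
    and v: "v \<in> homs Q q s" and w: "w \<in> homs Q q t"
  shows "(h' \<odot> h) \<odot> u \<preceq> w"
  unfolding cmp_assoc[OF u h h']
  using hom_trans[OF cmp_mono_right[OF assms(1) cmp_in[OF u h] v h'] assms(2)]
    cmp_in[OF cmp_in[OF u h] h'] cmp_in[OF v h'] w by blast

lemma cmp_chain_right:
  assumes "u \<odot> h \<preceq> v" "v \<odot> h' \<preceq> w"
    and u: "u \<in> homs Q s t" and h: "h \<in> homs Q r s" and h': "h' \<in> homs Q q r"
    and v: "v \<in> homs Q r t" and w: "w \<in> homs Q q t"
  shows "u \<odot> (h \<odot> h') \<preceq> w"
  unfolding cmp_assoc[OF h' h u, symmetric]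
  using hom_trans[OF cmp_mono_left[OF assms(1) cmp_in[OF h u] v h'] assms(2)]
    cmp_in[OF h' cmp_in[OF h u]] cmp_in[OF h' v] w by blast


section \<open>Enriched categories and functors\<close>

lemma qtype_in: "\<lbrakk>qcategory Q X; x \<in> qob X\<rbrakk> \<Longrightarrow> qtype X x \<in> obj Q"
  and qhom_in: "\<lbrakk>qcategory Q X; x \<in> qob X; x' \<in> qob X\<rbrakk>
    \<Longrightarrow> qhom X x x' \<in> homs Q (qtype X x) (qtype X x')"
  and qhom_ident: "\<lbrakk>qcategory Q X; x \<in> qob X\<rbrakk> \<Longrightarrow> ident Q (qtype X x) \<preceq> qhom X x x"
  by (auto simp: qcategory_def qrel_def)

lemma rcomp_family_in:
  assumes "qrel Q X Y \<phi>" "qrel Q Y Z \<psi>" "x \<in> qob X" "z \<in> qob Z"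
  shows "(\<lambda>y. \<psi> y z \<odot> \<phi> x y) ` qob Y \<subseteq> homs Q (qtype X x) (qtype Z z)"
  using assms cmp_in unfolding qrel_def by blast

lemma qrel_rcomp:
  assumes "qrel Q X Y \<phi>" "qrel Q Y Z \<psi>" "qtype X ` qob X \<subseteq> obj Q" "qtype Z ` qob Z \<subseteq> obj Q"
  shows "qrel Q X Z (rcomp Q X Y Z \<psi> \<phi>)"
  unfolding qrel_def rcomp_def
  using Sup_in[OF _ _ rcomp_family_in[OF assms(1,2)]] assms(3,4) by blast

lemma rcomp_le_iff:
  assumes "qrel Q X Y \<phi>" "qrel Q Y Z \<psi>" "x \<in> qob X" "z \<in> qob Z"
    and "w \<in> homs Q (qtype X x) (qtype Z z)"
  shows "rcomp Q X Y Z \<psi> \<phi> x z \<preceq> w \<longleftrightarrow> (\<forall>y \<in> qob Y. \<psi> y z \<odot> \<phi> x y \<preceq> w)"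
  unfolding rcomp_def
  using Sup_le_iff[OF _ _ rcomp_family_in[OF assms(1-4)] assms(5)] homsD[OF assms(5)] by simp

lemma qcategory_iff:
  "qcategory Q X \<longleftrightarrow> (\<forall>x \<in> qob X. qtype X x \<in> obj Q) \<and> qrel Q X X (qhom X) \<and>
     (\<forall>x \<in> qob X. ident Q (qtype X x) \<preceq> qhom X x x) \<and>
     (\<forall>x \<in> qob X. \<forall>y \<in> qob X. \<forall>z \<in> qob X. qhom X y z \<odot> qhom X x y \<preceq> qhom X x z)"
proof (cases "qrel Q X X (qhom X)")
  case True
  then have "rcomp Q X X X (qhom X) (qhom X) x z \<preceq> qhom X x z \<longleftrightarrow>
      (\<forall>y \<in> qob X. qhom X y z \<odot> qhom X x y \<preceq> qhom X x z)" if "x \<in> qob X" "z \<in> qob X" for x z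
    using rcomp_le_iff[OF True True] that by (simp add: qrel_def)
  then show ?thesis
    using True unfolding qcategory_def qrel_le_def by blast
qed (simp add: qcategory_def)

lemma qhom_trans:
  "\<lbrakk>qcategory Q X; x \<in> qob X; y \<in> qob X; z \<in> qob X\<rbrakk> \<Longrightarrow> qhom X y z \<odot> qhom X x y \<preceq> qhom X x z"
  by (simp add: qcategory_iff)

lemma qcategory_point: "s \<in> obj Q \<Longrightarrow> qcategory Q (point Q s)"
  using ident_in cmp_ident hom_refl by (fastforce simp: qcategory_iff qrel_def point_def)

lemma qfunctorD:
  assumes "qfunctor Q X Y f" "x \<in> qob X"
  shows qfunctor_ob: "f x \<in> qob Y" and qfunctor_type: "qtype Y (f x) = qtype X x"
    and qfunctor_hom: "x' \<in> qob X \<Longrightarrow> qhom X x x' \<preceq> qhom Y (f x) (f x')"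
  using assms by (auto simp: qfunctor_def)

lemma qfunctor_comp:
  assumes X: "qcategory Q X" and Y: "qcategory Q Y" and Z: "qcategory Q Z"
    and f: "qfunctor Q X Y f" and g: "qfunctor Q Y Z g"
  shows "qfunctor Q X Z (g \<circ> f)"
proof -
  have "qhom X x x' \<preceq> qhom Z (g (f x)) (g (f x'))" if x: "x \<in> qob X" and x': "x' \<in> qob X" for x x'
  proof (rule hom_trans)
    note fx = qfunctor_ob[OF f x] and fx' = qfunctor_ob[OF f x']
    note ty = qfunctor_type[OF f x] qfunctor_type[OF f x'] qfunctor_type[OF g fx]
      qfunctor_type[OF g fx']
    show "qhom X x x' \<preceq> qhom Y (f x) (f x')" using qfunctor_hom[OF f x x'] .
    show "qhom Y (f x) (f x') \<preceq> qhom Z (g (f x)) (g (f x'))" using qfunctor_hom[OF g fx fx'] .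
    show "qhom X x x' \<in> homs Q (qtype X x) (qtype X x')" using qhom_in[OF X x x'] .
    show "qhom Y (f x) (f x') \<in> homs Q (qtype X x) (qtype X x')"
      using qhom_in[OF Y fx fx'] by (simp add: ty)
    show "qhom Z (g (f x)) (g (f x')) \<in> homs Q (qtype X x) (qtype X x')"
      using qhom_in[OF Z qfunctor_ob[OF g fx] qfunctor_ob[OF g fx']] by (simp add: ty)
  qed
  then show ?thesis
    using qfunctor_ob[OF f] qfunctor_type[OF f] qfunctor_ob[OF g] qfunctor_type[OF g]
    unfolding qfunctor_def by simp
qed

text \<open>The two-sided condition defining a distributor splits into a condition for either side because
  identities lie below the homs.\<close>

lemma qdist_iff:
  assumes X: "qcategory Q X" and Y: "qcategory Q Y"
  shows "qdist Q X Y \<phi> \<longleftrightarrow> qrel Q X Y \<phi> \<and>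
    (\<forall>x \<in> qob X. \<forall>x' \<in> qob X. \<forall>y \<in> qob Y. \<phi> x' y \<odot> qhom X x x' \<preceq> \<phi> x y) \<and>
    (\<forall>x \<in> qob X. \<forall>y \<in> qob Y. \<forall>y' \<in> qob Y. qhom Y y y' \<odot> \<phi> x y \<preceq> \<phi> x y')"
proof (cases "qrel Q X Y \<phi>")
  case phi: True
  let ?L = "\<forall>x \<in> qob X. \<forall>x' \<in> qob X. \<forall>y \<in> qob Y. \<phi> x' y \<odot> qhom X x x' \<preceq> \<phi> x y"
  let ?R = "\<forall>x \<in> qob X. \<forall>y \<in> qob Y. \<forall>y' \<in> qob Y. qhom Y y y' \<odot> \<phi> x y \<preceq> \<phi> x y'"
  have pin: "\<phi> x y \<in> homs Q (qtype X x) (qtype Y y)" if "x \<in> qob X" "y \<in> qob Y" for x y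
    using phi that by (simp add: qrel_def)
  note Xin = qhom_in[OF X] and Yin = qhom_in[OF Y]
  have Xr: "qrel Q X X (qhom X)" and Yr: "qrel Q Y Y (qhom Y)"
    using X Y by (auto simp: qcategory_def)
  have tyX: "qtype X ` qob X \<subseteq> obj Q" and tyY: "qtype Y ` qob Y \<subseteq> obj Q"
    using qtype_in[OF X] qtype_in[OF Y] by auto
  let ?\<psi> = "rcomp Q X X Y \<phi> (qhom X)"
  have psi: "qrel Q X Y ?\<psi>"
    by (rule qrel_rcomp[OF Xr phi tyX tyY])
  have 1: "qhom Y y y' \<odot> ?\<psi> x y \<preceq> \<phi> x y' \<longleftrightarrow>
      (\<forall>x' \<in> qob X. qhom Y y y' \<odot> (\<phi> x' y \<odot> qhom X x x') \<preceq> \<phi> x y')"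
    if "x \<in> qob X" "y \<in> qob Y" "y' \<in> qob Y" for x y y'
    unfolding rcomp_def
    using cmp_Sup_le_iff[OF rcomp_family_in[OF Xr phi] Yin pin] that qtype_in[OF X] by simp
  have iff: "qdist Q X Y \<phi> \<longleftrightarrow> (\<forall>x \<in> qob X. \<forall>x' \<in> qob X. \<forall>y \<in> qob Y. \<forall>y' \<in> qob Y.
      qhom Y y y' \<odot> (\<phi> x' y \<odot> qhom X x x') \<preceq> \<phi> x y')"
    unfolding qdist_def qrel_le_def
    using rcomp_le_iff[OF psi Yr _ _ pin] 1 phi by auto
  show ?thesis
    unfolding iff
  proof (intro iffI conjI ballI)
    assume H: "\<forall>x \<in> qob X. \<forall>x' \<in> qob X. \<forall>y \<in> qob Y. \<forall>y' \<in> qob Y.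
      qhom Y y y' \<odot> (\<phi> x' y \<odot> qhom X x x') \<preceq> \<phi> x y'"
    show "qrel Q X Y \<phi>" by (rule phi)
    show "\<phi> x' y \<odot> qhom X x x' \<preceq> \<phi> x y" if x: "x \<in> qob X" and x': "x' \<in> qob X"
      and y: "y \<in> qob Y" for x x' y
    proof (rule hom_trans)
      note p = cmp_in[OF Xin[OF x x'] pin[OF x' y]]
      show "\<phi> x' y \<odot> qhom X x x' \<preceq> qhom Y y y \<odot> (\<phi> x' y \<odot> qhom X x x')"
        using cmp_mono_left[OF qhom_ident[OF Y y] ident_in[OF qtype_in[OF Y y]] Yin[OF y y] p]
          cmp_ident[OF p] by simp
      show "qhom Y y y \<odot> (\<phi> x' y \<odot> qhom X x x') \<preceq> \<phi> x y" using H that by blast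
      show "qhom Y y y \<odot> (\<phi> x' y \<odot> qhom X x x') \<in> homs Q (qtype X x) (qtype Y y)"
        by (rule cmp_in[OF p Yin[OF y y]])
    qed (use that pin cmp_in Xin in blast)+
    show "qhom Y y y' \<odot> \<phi> x y \<preceq> \<phi> x y'" if x: "x \<in> qob X" and y: "y \<in> qob Y"
      and y': "y' \<in> qob Y" for x y y'
    proof (rule hom_trans)
      note p = pin[OF x y] and Xx = Xin[OF x x]
      have "\<phi> x y \<preceq> \<phi> x y \<odot> qhom X x x"
        using cmp_mono_right[OF qhom_ident[OF X x] ident_in[OF qtype_in[OF X x]] Xx p]
          cmp_ident[OF p] by simp
      then show "qhom Y y y' \<odot> \<phi> x y \<preceq> qhom Y y y' \<odot> (\<phi> x y \<odot> qhom X x x)"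
        using cmp_mono_right[OF _ p cmp_in[OF Xx p] Yin[OF y y']] by blast
      show "qhom Y y y' \<odot> (\<phi> x y \<odot> qhom X x x) \<preceq> \<phi> x y'" using H that by blast
      show "qhom Y y y' \<odot> (\<phi> x y \<odot> qhom X x x) \<in> homs Q (qtype X x) (qtype Y y')"
        by (rule cmp_in[OF cmp_in[OF Xx p] Yin[OF y y']])
    qed (use that pin cmp_in Yin in blast)+
  next
    fix x x' y y'
    assume H: "qrel Q X Y \<phi> \<and> ?L \<and> ?R"
      and x: "x \<in> qob X" and x': "x' \<in> qob X" and y: "y \<in> qob Y" and y': "y' \<in> qob Y"
    note p = cmp_in[OF Xin[OF x x'] pin[OF x' y]]
    show "qhom Y y y' \<odot> (\<phi> x' y \<odot> qhom X x x') \<preceq> \<phi> x y'"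
    proof (rule hom_trans)
      show "qhom Y y y' \<odot> (\<phi> x' y \<odot> qhom X x x') \<preceq> qhom Y y y' \<odot> \<phi> x y"
        using cmp_mono_right[OF _ p pin[OF x y] Yin[OF y y']] H x x' y by blast
      show "qhom Y y y' \<odot> \<phi> x y \<preceq> \<phi> x y'" using H x y y' by blast
      show "qhom Y y y' \<odot> (\<phi> x' y \<odot> qhom X x x') \<in> homs Q (qtype X x) (qtype Y y')"
        by (rule cmp_in[OF p Yin[OF y y']])
    qed (use x y y' pin cmp_in Yin in blast)+
  qed
qed (simp add: qdist_def)

section \<open>Presheaves\<close>

lemma Psh_mem_iff:
  assumes X: "qcategory Q X"
  shows "p \<in> qob (Psh Q X) \<longleftrightarrow> fst p \<in> obj Q \<and> snd p \<in> extensional (qob X) \<and>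
    (\<forall>x \<in> qob X. snd p x \<in> homs Q (qtype X x) (fst p)) \<and>
    (\<forall>x \<in> qob X. \<forall>x' \<in> qob X. snd p x' \<odot> qhom X x x' \<preceq> snd p x)"
proof (cases "fst p \<in> obj Q")
  case s: True
  have "qdist Q X (point Q (fst p)) (\<lambda>x _. snd p x) \<longleftrightarrow>
    (\<forall>x \<in> qob X. snd p x \<in> homs Q (qtype X x) (fst p)) \<and>
    (\<forall>x \<in> qob X. \<forall>x' \<in> qob X. snd p x' \<odot> qhom X x x' \<preceq> snd p x)"
  proof -
    have "ident Q (fst p) \<odot> snd p x \<preceq> snd p x" if "snd p x \<in> homs Q (qtype X x) (fst p)" for x
      using cmp_ident[OF that] hom_refl[OF that] by simp
    then show ?thesis
      unfolding qdist_iff[OF X qcategory_point[OF s]] by (auto simp: qrel_def point_def)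
  qed
  then show ?thesis by (simp add: Psh_def case_prod_unfold s)
qed (simp add: Psh_def case_prod_unfold)

lemma PshD:
  assumes "qcategory Q X" "p \<in> qob (Psh Q X)"
  shows Psh_type: "fst p \<in> obj Q"
    and Psh_extensional: "snd p \<in> extensional (qob X)"
    and Psh_val: "x \<in> qob X \<Longrightarrow> snd p x \<in> homs Q (qtype X x) (fst p)"
    and Psh_action: "\<lbrakk>x \<in> qob X; x' \<in> qob X\<rbrakk> \<Longrightarrow> snd p x' \<odot> qhom X x x' \<preceq> snd p x"
  using assms by (auto simp: Psh_mem_iff)

lemma qtype_Psh [simp]: "qtype (Psh Q X) = fst"
  by (simp add: Psh_def)

lemma Psh_hom:
  assumes X: "qcategory Q X" and p: "p \<in> qob (Psh Q X)" and p': "p' \<in> qob (Psh Q X)"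
  shows Psh_hom_in: "qhom (Psh Q X) p p' \<in> homs Q (fst p) (fst p')"
    and le_Psh_hom_iff: "u \<in> homs Q (fst p) (fst p') \<Longrightarrow>
      u \<preceq> qhom (Psh Q X) p p' \<longleftrightarrow> (\<forall>x \<in> qob X. u \<odot> snd p x \<preceq> snd p' x)"
proof -
  let ?U = "(\<lambda>x. lres Q (snd p' x) (snd p x)) ` qob X"
  have eq: "qhom (Psh Q X) p p' = \<Sqinter>\<^bsub>homl Q (fst p) (fst p')\<^esub> ?U"
    by (simp add: Psh_def case_prod_unfold)
  have U: "?U \<subseteq> homs Q (fst p) (fst p')"
    using lres_in[OF Psh_val[OF X p] Psh_val[OF X p']] by blast
  note ob = Psh_type[OF X p] Psh_type[OF X p']
  show "qhom (Psh Q X) p p' \<in> homs Q (fst p) (fst p')"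
    unfolding eq by (rule Inf_in[OF ob U])
  show "u \<in> homs Q (fst p) (fst p') \<Longrightarrow>
      u \<preceq> qhom (Psh Q X) p p' \<longleftrightarrow> (\<forall>x \<in> qob X. u \<odot> snd p x \<preceq> snd p' x)"
    unfolding eq using le_Inf_iff[OF ob U] le_lres_iff[OF Psh_val[OF X p] Psh_val[OF X p']] by simp
qed

lemma Psh_hom_action:
  assumes "qcategory Q X" "p \<in> qob (Psh Q X)" "p' \<in> qob (Psh Q X)" "x \<in> qob X"
  shows "qhom (Psh Q X) p p' \<odot> snd p x \<preceq> snd p' x"
  using le_Psh_hom_iff[OF assms(1-3) Psh_hom_in[OF assms(1-3)]] assms(4)
    hom_refl[OF Psh_hom_in[OF assms(1-3)]] by blast

lemma ident_le_Psh_hom_iff: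
  assumes X: "qcategory Q X" and p: "p \<in> qob (Psh Q X)" and p': "p' \<in> qob (Psh Q X)"
    and ty: "fst p = fst p'"
  shows "ident Q (fst p) \<preceq> qhom (Psh Q X) p p' \<longleftrightarrow> (\<forall>x \<in> qob X. snd p x \<preceq> snd p' x)"
  using le_Psh_hom_iff[OF X p p'] ident_in[OF Psh_type[OF X p]] cmp_ident[OF Psh_val[OF X p]] ty
  by simp

lemma qle_Psh_iff:
  assumes "qcategory Q X" "p \<in> qob (Psh Q X)" "p' \<in> qob (Psh Q X)"
  shows "qle Q (Psh Q X) p p' \<longleftrightarrow> fst p = fst p' \<and> (\<forall>x \<in> qob X. snd p x \<preceq> snd p' x)"
  using ident_le_Psh_hom_iff[OF assms] by (auto simp: qle_def)

lemma qcategory_Psh: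
  assumes X: "qcategory Q X"
  shows "qcategory Q (Psh Q X)"
proof -
  note P = Psh_hom_in[OF X]
  have id: "ident Q (fst p) \<preceq> qhom (Psh Q X) p p" if p: "p \<in> qob (Psh Q X)" for p
    using ident_le_Psh_hom_iff[OF X p p] hom_refl[OF Psh_val[OF X p]] by simp
  have comp: "qhom (Psh Q X) p' p'' \<odot> qhom (Psh Q X) p p' \<preceq> qhom (Psh Q X) p p''"
    if p: "p \<in> qob (Psh Q X)" and p': "p' \<in> qob (Psh Q X)" and p'': "p'' \<in> qob (Psh Q X)" for p p' p''
    using le_Psh_hom_iff[OF X p p'' cmp_in[OF P[OF p p'] P[OF p' p'']]]
      cmp_chain_left[OF Psh_hom_action[OF X p p'] Psh_hom_action[OF X p' p''] Psh_val[OF X p]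
        P[OF p p'] P[OF p' p''] Psh_val[OF X p'] Psh_val[OF X p'']] by blast
  show ?thesis
    using id comp P Psh_type[OF X] by (simp add: qcategory_iff qrel_def)
qed

lemma fst_yon [simp]: "fst (yon X x) = qtype X x"
  and snd_yon [simp]: "x' \<in> qob X \<Longrightarrow> snd (yon X x) x' = qhom X x' x"
  by (simp_all add: yon_def)

lemma yon_in: "\<lbrakk>qcategory Q X; x \<in> qob X\<rbrakk> \<Longrightarrow> yon X x \<in> qob (Psh Q X)"
  using qhom_in[of X] qhom_trans[of X] qtype_in[of X]
  by (auto simp: Psh_mem_iff) (simp add: yon_def)

lemma yoneda:
  assumes X: "qcategory Q X" and x: "x \<in> qob X" and p: "p \<in> qob (Psh Q X)"
  shows "qhom (Psh Q X) (yon X x) p = snd p x"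
proof (rule hom_antisym)
  note y = yon_in[OF X x]
  let ?h = "qhom (Psh Q X) (yon X x) p"
  show h: "?h \<in> homs Q (qtype X x) (fst p)"
    using Psh_hom_in[OF X y p] by simp
  show px: "snd p x \<in> homs Q (qtype X x) (fst p)"
    by (rule Psh_val[OF X p x])
  have "?h \<preceq> ?h \<odot> qhom X x x"
    using cmp_mono_right[OF qhom_ident[OF X x] ident_in[OF qtype_in[OF X x]] qhom_in[OF X x x] h]
      cmp_ident[OF h] by simp
  then show "?h \<preceq> snd p x"
    by (rule hom_trans)
      (use Psh_hom_action[OF X y p x] h px cmp_in[OF qhom_in[OF X x x] h] x in simp_all)
  show "snd p x \<preceq> ?h"
    using le_Psh_hom_iff[OF X y p, of "snd p x"] px Psh_action[OF X p _ x] by simp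
qed

lemma yon_functor:
  assumes X: "qcategory Q X"
  shows "qfunctor Q X (Psh Q X) (yon X)"
  using yon_in[OF X] hom_refl[OF qhom_in[OF X]] yoneda[OF X _ yon_in[OF X]]
  by (auto simp: qfunctor_def)

lemma fst_psh_u [simp]: "fst (psh_u Q X Y f p) = fst p"
  by (simp add: psh_u_def case_prod_unfold)

lemma fst_psh_l [simp]: "fst (psh_l Q X Y f p) = fst p"
  by (simp add: psh_l_def case_prod_unfold)

text \<open>The supremum defining the upper decoration is attained at \<open>f x\<close>, because the presheaf absorbs
  homs and identities lie below them. Thus \<open>f\<^sup>!\<close> is precomposition with \<open>f\<close>.\<close>

lemma psh_u_eq:
  assumes X: "qcategory Q X" and Y: "qcategory Q Y" and f: "qfunctor Q X Y f"
    and p: "p \<in> qob (Psh Q Y)"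
  shows "psh_u Q X Y f p = (fst p, \<lambda>x \<in> qob X. snd p (f x))"
proof -
  have "rcomp Q X Y (point Q (fst p)) (\<lambda>y _. snd p y) (lgraph Y f) x (fst p) = snd p (f x)"
    if x: "x \<in> qob X" for x
  proof -
    note fx = qfunctor_ob[OF f x] and ty = qfunctor_type[OF f x]
    note val = Psh_val[OF Y p]
    show ?thesis
      unfolding rcomp_def
    proof (rule Sup_eqI)
      show "(\<lambda>y. snd p y \<odot> lgraph Y f x y) ` qob Y
          \<subseteq> homs Q (qtype X x) (qtype (point Q (fst p)) (fst p))"
        using cmp_in[OF qhom_in[OF Y fx] val] ty by (auto simp: lgraph_def point_def)
      show "snd p (f x) \<in> homs Q (qtype X x) (qtype (point Q (fst p)) (fst p))"
        using val[OF fx] ty by (simp add: point_def)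
      show "snd p (f x) \<odot> lgraph Y f x (f x) \<in> (\<lambda>y. snd p y \<odot> lgraph Y f x y) ` qob Y"
        using fx by blast
      show "snd p (f x) \<preceq> snd p (f x) \<odot> lgraph Y f x (f x)"
        using cmp_mono_right[OF qhom_ident[OF Y fx] ident_in[OF qtype_in[OF Y fx]]
            qhom_in[OF Y fx fx] val[OF fx]] cmp_ident[OF val[OF fx]]
        by (simp add: lgraph_def)
      show "u \<preceq> snd p (f x)" if "u \<in> (\<lambda>y. snd p y \<odot> lgraph Y f x y) ` qob Y" for u
        using that Psh_action[OF Y p fx] by (auto simp: lgraph_def)
    qed
  qed
  then show ?thesis
    by (auto simp: psh_u_def case_prod_unfold intro!: restrict_ext)
qed

lemma snd_psh_u:
  assumes "qcategory Q X" "qcategory Q Y" "qfunctor Q X Y f" "p \<in> qob (Psh Q Y)" "x \<in> qob X"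
  shows "snd (psh_u Q X Y f p) x = snd p (f x)"
  using assms by (simp add: psh_u_eq)

lemma psh_u_functor:
  assumes X: "qcategory Q X" and Y: "qcategory Q Y" and f: "qfunctor Q X Y f"
  shows "qfunctor Q (Psh Q Y) (Psh Q X) (psh_u Q X Y f)"
proof -
  note fo = qfunctor_ob[OF f] and ft = qfunctor_type[OF f] and fh = qfunctor_hom[OF f]
  have in_Psh: "psh_u Q X Y f p \<in> qob (Psh Q X)" if p: "p \<in> qob (Psh Q Y)" for p
  proof -
    have val: "snd p (f x) \<in> homs Q (qtype X x) (fst p)" if "x \<in> qob X" for x
      using Psh_val[OF Y p fo] ft that by fastforce
    have "snd p (f x') \<odot> qhom X x x' \<preceq> snd p (f x)" if x: "x \<in> qob X" and x': "x' \<in> qob X" for x x'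
    proof (rule hom_trans)
      have Yh: "qhom Y (f x) (f x') \<in> homs Q (qtype X x) (qtype X x')"
        using qhom_in[OF Y fo[OF x] fo[OF x']] ft x x' by simp
      show "snd p (f x') \<odot> qhom X x x' \<preceq> snd p (f x') \<odot> qhom Y (f x) (f x')"
        by (rule cmp_mono_right[OF fh[OF x x'] qhom_in[OF X x x'] Yh val[OF x']])
      show "snd p (f x') \<odot> qhom Y (f x) (f x') \<preceq> snd p (f x)"
        by (rule Psh_action[OF Y p fo[OF x] fo[OF x']])
      show "snd p (f x') \<odot> qhom X x x' \<in> homs Q (qtype X x) (fst p)"
        by (rule cmp_in[OF qhom_in[OF X x x'] val[OF x']])
      show "snd p (f x') \<odot> qhom Y (f x) (f x') \<in> homs Q (qtype X x) (fst p)"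
        by (rule cmp_in[OF Yh val[OF x']])
    qed (rule val[OF x])
    then show ?thesis
      using val Psh_type[OF Y p] by (simp add: Psh_mem_iff[OF X] psh_u_eq[OF X Y f p])
  qed
  moreover have "qhom (Psh Q Y) p p' \<preceq> qhom (Psh Q X) (psh_u Q X Y f p) (psh_u Q X Y f p')"
    if p: "p \<in> qob (Psh Q Y)" and p': "p' \<in> qob (Psh Q Y)" for p p'
    using le_Psh_hom_iff[OF X in_Psh[OF p] in_Psh[OF p']] Psh_hom_in[OF Y p p']
      Psh_hom_action[OF Y p p' fo] snd_psh_u[OF X Y f p] snd_psh_u[OF X Y f p'] by simp
  ultimately show ?thesis by (simp add: qfunctor_def)
qed

context
  fixes X :: "('a, 'o, 'm) qcat_data" and Y :: "('b, 'o, 'm) qcat_data" and f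
  assumes X: "qcategory Q X" and Y: "qcategory Q Y" and f: "qfunctor Q X Y f"
begin

lemma psh_l_family_in:
  assumes "p \<in> qob (Psh Q X)" "y \<in> qob Y"
  shows "(\<lambda>x. snd p x \<odot> qhom Y y (f x)) ` qob X \<subseteq> homs Q (qtype Y y) (fst p)"
  using cmp_in[OF qhom_in[OF Y assms(2) qfunctor_ob[OF f]]] Psh_val[OF X assms(1)]
    qfunctor_type[OF f] by fastforce

lemma snd_psh_l: "y \<in> qob Y \<Longrightarrow> snd (psh_l Q X Y f p) y =
    \<Squnion>\<^bsub>homl Q (qtype Y y) (fst p)\<^esub> ((\<lambda>x. snd p x \<odot> qhom Y y (f x)) ` qob X)"
  by (simp add: psh_l_def case_prod_unfold rcomp_def point_def ugraph_def)

lemma psh_l_in: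
  assumes p: "p \<in> qob (Psh Q X)"
  shows "psh_l Q X Y f p \<in> qob (Psh Q Y)"
proof -
  note fam = psh_l_family_in[OF p] and s = Psh_type[OF X p]
  have val: "snd (psh_l Q X Y f p) y \<in> homs Q (qtype Y y) (fst p)" if "y \<in> qob Y" for y
    using Sup_in[OF qtype_in[OF Y that] s fam[OF that]] snd_psh_l[OF that] by simp
  have "snd (psh_l Q X Y f p) y' \<odot> qhom Y y y' \<preceq> snd (psh_l Q X Y f p) y"
    if y: "y \<in> qob Y" and y': "y' \<in> qob Y" for y y'
  proof -
    have "(snd p x \<odot> qhom Y y' (f x)) \<odot> qhom Y y y' \<preceq> snd (psh_l Q X Y f p) y"
      if x: "x \<in> qob X" for x
    proof -
      note fx = qfunctor_ob[OF f x]
      have px: "snd p x \<in> homs Q (qtype Y (f x)) (fst p)"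
        using Psh_val[OF X p x] qfunctor_type[OF f x] by simp
      note Yh = qhom_in[OF Y]
      have "snd p x \<odot> (qhom Y y' (f x) \<odot> qhom Y y y') \<preceq> snd p x \<odot> qhom Y y (f x)"
        by (rule cmp_mono_right[OF qhom_trans[OF Y y y' fx] cmp_in[OF Yh[OF y y'] Yh[OF y' fx]]
              Yh[OF y fx] px])
      moreover have "snd p x \<odot> qhom Y y (f x) \<preceq> snd (psh_l Q X Y f p) y"
        unfolding snd_psh_l[OF y] by (rule le_Sup[OF qtype_in[OF Y y] s fam[OF y] imageI[OF x]])
      ultimately show ?thesis
        unfolding cmp_assoc[OF Yh[OF y y'] Yh[OF y' fx] px]
        by (rule hom_trans[OF _ _ cmp_in[OF cmp_in[OF Yh[OF y y'] Yh[OF y' fx]] px]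
              cmp_in[OF Yh[OF y fx] px] val[OF y]])
    qed
    then show ?thesis
      using Sup_cmp_le_iff[OF fam[OF y'] qhom_in[OF Y y y'] val[OF y] s]
      by (simp add: snd_psh_l[OF y'])
  qed
  then show ?thesis
    using val s by (simp add: Psh_mem_iff[OF Y])
      (simp add: psh_l_def case_prod_unfold)
qed

text \<open>The adjunction between the lower and the upper decoration, stated for homs: out of a supremum of
  composites, an arrow into \<open>q\<close> is a family of inequalities over all \<open>x\<close> and \<open>y\<close>, of which those
  with \<open>y = f x\<close> imply the others.\<close>

lemma psh_adjunction:
  assumes p: "p \<in> qob (Psh Q X)" and q: "q \<in> qob (Psh Q Y)"
  shows "qhom (Psh Q Y) (psh_l Q X Y f p) q = qhom (Psh Q X) p (psh_u Q X Y f q)"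
proof (rule hom_eqI)
  note fo = qfunctor_ob[OF f]
  note uq = qfunctor_ob[OF psh_u_functor[OF X Y f] q]
  note lp = psh_l_in[OF p]
  show "qhom (Psh Q Y) (psh_l Q X Y f p) q \<in> homs Q (fst p) (fst q)"
    using Psh_hom_in[OF Y lp q] by simp
  show "qhom (Psh Q X) p (psh_u Q X Y f q) \<in> homs Q (fst p) (fst q)"
    using Psh_hom_in[OF X p uq] by simp
  fix u assume u: "u \<in> homs Q (fst p) (fst q)"
  have px: "snd p x \<in> homs Q (qtype Y (f x)) (fst p)" if "x \<in> qob X" for x
    using Psh_val[OF X p that] qfunctor_type[OF f that] by simp
  have "u \<preceq> qhom (Psh Q Y) (psh_l Q X Y f p) q \<longleftrightarrow>
      (\<forall>y \<in> qob Y. \<forall>x \<in> qob X. u \<odot> (snd p x \<odot> qhom Y y (f x)) \<preceq> snd q y)"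
    using le_Psh_hom_iff[OF Y lp q] u
      cmp_Sup_le_iff[OF psh_l_family_in[OF p] u Psh_val[OF Y q] qtype_in[OF Y]]
    by (simp add: snd_psh_l)
  also have "\<dots> \<longleftrightarrow> (\<forall>x \<in> qob X. u \<odot> snd p x \<preceq> snd q (f x))"
  proof (intro iffI ballI)
    fix x assume x: "x \<in> qob X"
      and H: "\<forall>y \<in> qob Y. \<forall>x \<in> qob X. u \<odot> (snd p x \<odot> qhom Y y (f x)) \<preceq> snd q y"
    note fx = fo[OF x] and Yh = qhom_in[OF Y fo[OF x] fo[OF x]] and up = cmp_in[OF px[OF x] u]
    have "u \<odot> snd p x \<preceq> (u \<odot> snd p x) \<odot> qhom Y (f x) (f x)"
      using cmp_mono_right[OF qhom_ident[OF Y fx] ident_in[OF qtype_in[OF Y fx]] Yh up]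
        cmp_ident[OF up] by simp
    moreover have "(u \<odot> snd p x) \<odot> qhom Y (f x) (f x) \<preceq> snd q (f x)"
      using H x fx cmp_assoc[OF Yh px[OF x] u] by simp
    ultimately show "u \<odot> snd p x \<preceq> snd q (f x)"
      by (rule hom_trans[OF _ _ up cmp_in[OF Yh up] Psh_val[OF Y q fx]])
  next
    fix x y assume x: "x \<in> qob X" and y: "y \<in> qob Y"
      and H: "\<forall>x \<in> qob X. u \<odot> snd p x \<preceq> snd q (f x)"
    note fx = fo[OF x] and Yh = qhom_in[OF Y y fo[OF x]] and up = cmp_in[OF px[OF x] u]
    show "u \<odot> (snd p x \<odot> qhom Y y (f x)) \<preceq> snd q y"
      using cmp_chain_right[OF _ Psh_action[OF Y q y fx] u px[OF x] Yh Psh_val[OF Y q fx]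
          Psh_val[OF Y q y]] H x by blast
  qed
  also have "\<dots> \<longleftrightarrow> u \<preceq> qhom (Psh Q X) p (psh_u Q X Y f q)"
    using le_Psh_hom_iff[OF X p uq] u by (simp add: snd_psh_u[OF X Y f q])
  finally show "u \<preceq> qhom (Psh Q Y) (psh_l Q X Y f p) q \<longleftrightarrow>
      u \<preceq> qhom (Psh Q X) p (psh_u Q X Y f q)" .
qed

lemma qle_psh_l_iff:
  assumes p: "p \<in> qob (Psh Q X)" and q: "q \<in> qob (Psh Q Y)"
  shows "qle Q (Psh Q Y) (psh_l Q X Y f p) q \<longleftrightarrow>
    fst p = fst q \<and> (\<forall>x \<in> qob X. snd p x \<preceq> snd q (f x))"
proof -
  have "qle Q (Psh Q Y) (psh_l Q X Y f p) q \<longleftrightarrow> qle Q (Psh Q X) p (psh_u Q X Y f q)"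
    using psh_adjunction[OF p q] by (simp add: qle_def)
  then show ?thesis
    using qle_Psh_iff[OF X p qfunctor_ob[OF psh_u_functor[OF X Y f] q]]
    by (simp add: snd_psh_u[OF X Y f q])
qed

text \<open>The inequality of homs is obtained from the adjunction: after transposing, the claim is composition with
  the unit of the adjunction.\<close>

lemma psh_l_functor: "qfunctor Q (Psh Q X) (Psh Q Y) (psh_l Q X Y f)"
proof -
  let ?l = "psh_l Q X Y f" and ?u = "psh_u Q X Y f"
  have "qhom (Psh Q X) p p' \<preceq> qhom (Psh Q Y) (?l p) (?l p')"
    if p: "p \<in> qob (Psh Q X)" and p': "p' \<in> qob (Psh Q X)" for p p'
  proof -
    note l = psh_l_in[OF p'] and PX = qcategory_Psh[OF X] and PY = qcategory_Psh[OF Y]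
    note ul = qfunctor_ob[OF psh_u_functor[OF X Y f] l]
    note P = Psh_hom_in[OF X]
    have "ident Q (fst p') \<preceq> qhom (Psh Q X) p' (?u (?l p'))"
      using qhom_ident[OF PY l] psh_adjunction[OF p' l] by simp
    then have "qhom (Psh Q X) p p' \<preceq> qhom (Psh Q X) p' (?u (?l p')) \<odot> qhom (Psh Q X) p p'"
      using cmp_mono_left[OF _ ident_in[OF Psh_type[OF X p']] _ P[OF p p']] P[OF p' ul]
        cmp_ident[OF P[OF p p']] by simp
    also have "qhom (Psh Q X) p' (?u (?l p')) \<odot> qhom (Psh Q X) p p' \<preceq> qhom (Psh Q X) p (?u (?l p'))"
      by (rule qhom_trans[OF PX p p' ul])
    finally (hom_trans) have "qhom (Psh Q X) p p' \<preceq> qhom (Psh Q X) p (?u (?l p'))"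
      using P[OF p p'] P[OF p ul] cmp_in[OF P[OF p p'] P[OF p' ul]] by simp
    then show ?thesis by (simp add: psh_adjunction[OF p l])
  qed
  then show ?thesis
    using psh_l_in by (simp add: qfunctor_def)
qed

lemma psh_l_yon:
  assumes x: "x \<in> qob X"
  shows "psh_l Q X Y f (yon X x) = yon Y (f x)"
proof -
  note fx = qfunctor_ob[OF f x] and ty = qfunctor_type[OF f x]
  have "\<Squnion>\<^bsub>homl Q (qtype Y y) (qtype X x)\<^esub> ((\<lambda>x'. snd (yon X x) x' \<odot> qhom Y y (f x')) ` qob X)
      = qhom Y y (f x)" if y: "y \<in> qob Y" for y
  proof (rule Sup_eqI)
    note Yy = qhom_in[OF Y y]
    show "(\<lambda>x'. snd (yon X x) x' \<odot> qhom Y y (f x')) ` qob X \<subseteq> homs Q (qtype Y y) (qtype X x)"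
      using psh_l_family_in[OF yon_in[OF X x] y] by simp
    show "qhom Y y (f x) \<in> homs Q (qtype Y y) (qtype X x)"
      using Yy[OF fx] ty by simp
    show "snd (yon X x) x \<odot> qhom Y y (f x) \<in> (\<lambda>x'. snd (yon X x) x' \<odot> qhom Y y (f x')) ` qob X"
      using x by blast
    show "qhom Y y (f x) \<preceq> snd (yon X x) x \<odot> qhom Y y (f x)"
      using cmp_mono_left[OF qhom_ident[OF X x] ident_in[OF qtype_in[OF X x]] qhom_in[OF X x x]
          Yy[OF fx, unfolded ty]] cmp_ident[OF Yy[OF fx, unfolded ty]] x by simp
    show "u \<preceq> qhom Y y (f x)"
      if mem: "u \<in> (\<lambda>x'. snd (yon X x) x' \<odot> qhom Y y (f x')) ` qob X" for u
    proof -
      obtain x' where x': "x' \<in> qob X" and "u = snd (yon X x) x' \<odot> qhom Y y (f x')"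
        using mem by blast
      then have u: "u = qhom X x' x \<odot> qhom Y y (f x')" by simp
      note fx' = qfunctor_ob[OF f x'] and ty' = qfunctor_type[OF f x']
      note Xh = qhom_in[OF X x' x, folded ty ty']
      have "u \<preceq> qhom Y (f x') (f x) \<odot> qhom Y y (f x')"
        unfolding u
        by (rule cmp_mono_left[OF qfunctor_hom[OF f x' x] Xh qhom_in[OF Y fx' fx] Yy[OF fx']])
      then show ?thesis
        by (rule hom_trans[OF _ qhom_trans[OF Y y fx' fx]])
          (use u cmp_in[OF Yy[OF fx'] Xh] cmp_in[OF Yy[OF fx'] qhom_in[OF Y fx' fx]] Yy[OF fx] in auto)
    qed
  qed
  then have "psh_l Q X Y f (yon X x) = (qtype X x, \<lambda>y \<in> qob Y. qhom Y y (f x))"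
    by (auto simp: psh_l_def case_prod_unfold rcomp_def point_def ugraph_def intro!: restrict_ext)
  then show ?thesis by (simp add: yon_def ty)
qed

end


section \<open>Copresheaves\<close>

text \<open>The statements are those for presheaves with arrows of the quantaloid reversed. The hom keeps
  its direction, so a larger copresheaf has smaller values.\<close>

lemma Copsh_mem_iff:
  assumes X: "qcategory Q X"
  shows "p \<in> qob (Copsh Q X) \<longleftrightarrow> fst p \<in> obj Q \<and> snd p \<in> extensional (qob X) \<and>
    (\<forall>x \<in> qob X. snd p x \<in> homs Q (fst p) (qtype X x)) \<and>
    (\<forall>x \<in> qob X. \<forall>x' \<in> qob X. qhom X x x' \<odot> snd p x \<preceq> snd p x')"
proof (cases "fst p \<in> obj Q")
  case s: True
  have "qdist Q (point Q (fst p)) X (\<lambda>_ x. snd p x) \<longleftrightarrow>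
    (\<forall>x \<in> qob X. snd p x \<in> homs Q (fst p) (qtype X x)) \<and>
    (\<forall>x \<in> qob X. \<forall>x' \<in> qob X. qhom X x x' \<odot> snd p x \<preceq> snd p x')"
  proof -
    have "snd p x \<odot> ident Q (fst p) \<preceq> snd p x" if "snd p x \<in> homs Q (fst p) (qtype X x)" for x
      using cmp_ident[OF that] hom_refl[OF that] by simp
    then show ?thesis
      unfolding qdist_iff[OF qcategory_point[OF s] X] by (auto simp: qrel_def point_def)
  qed
  then show ?thesis by (simp add: Copsh_def case_prod_unfold s)
qed (simp add: Copsh_def case_prod_unfold)

lemma CopshD:
  assumes "qcategory Q X" "p \<in> qob (Copsh Q X)"
  shows Copsh_type: "fst p \<in> obj Q"
    and Copsh_extensional: "snd p \<in> extensional (qob X)"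
    and Copsh_val: "x \<in> qob X \<Longrightarrow> snd p x \<in> homs Q (fst p) (qtype X x)"
    and Copsh_action: "\<lbrakk>x \<in> qob X; x' \<in> qob X\<rbrakk> \<Longrightarrow> qhom X x x' \<odot> snd p x \<preceq> snd p x'"
  using assms by (auto simp: Copsh_mem_iff)

lemma qtype_Copsh [simp]: "qtype (Copsh Q X) = fst"
  by (simp add: Copsh_def)

lemma Copsh_hom:
  assumes X: "qcategory Q X" and p: "p \<in> qob (Copsh Q X)" and p': "p' \<in> qob (Copsh Q X)"
  shows Copsh_hom_in: "qhom (Copsh Q X) p p' \<in> homs Q (fst p) (fst p')"
    and le_Copsh_hom_iff: "u \<in> homs Q (fst p) (fst p') \<Longrightarrow>
      u \<preceq> qhom (Copsh Q X) p p' \<longleftrightarrow> (\<forall>x \<in> qob X. snd p' x \<odot> u \<preceq> snd p x)"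
proof -
  let ?U = "(\<lambda>x. rres Q (snd p' x) (snd p x)) ` qob X"
  have eq: "qhom (Copsh Q X) p p' = \<Sqinter>\<^bsub>homl Q (fst p) (fst p')\<^esub> ?U"
    by (simp add: Copsh_def case_prod_unfold)
  have U: "?U \<subseteq> homs Q (fst p) (fst p')"
    using rres_in[OF Copsh_val[OF X p'] Copsh_val[OF X p]] by blast
  note ob = Copsh_type[OF X p] Copsh_type[OF X p']
  show "qhom (Copsh Q X) p p' \<in> homs Q (fst p) (fst p')"
    unfolding eq by (rule Inf_in[OF ob U])
  show "u \<in> homs Q (fst p) (fst p') \<Longrightarrow>
      u \<preceq> qhom (Copsh Q X) p p' \<longleftrightarrow> (\<forall>x \<in> qob X. snd p' x \<odot> u \<preceq> snd p x)"
    unfolding eq using le_Inf_iff[OF ob U] le_rres_iff[OF Copsh_val[OF X p'] Copsh_val[OF X p]]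
    by simp
qed

lemma Copsh_hom_action:
  assumes "qcategory Q X" "p \<in> qob (Copsh Q X)" "p' \<in> qob (Copsh Q X)" "x \<in> qob X"
  shows "snd p' x \<odot> qhom (Copsh Q X) p p' \<preceq> snd p x"
  using le_Copsh_hom_iff[OF assms(1-3) Copsh_hom_in[OF assms(1-3)]] assms(4)
    hom_refl[OF Copsh_hom_in[OF assms(1-3)]] by blast

lemma qcategory_Copsh:
  assumes X: "qcategory Q X"
  shows "qcategory Q (Copsh Q X)"
proof -
  note P = Copsh_hom_in[OF X]
  have id: "ident Q (fst p) \<preceq> qhom (Copsh Q X) p p" if p: "p \<in> qob (Copsh Q X)" for p
    using le_Copsh_hom_iff[OF X p p ident_in[OF Copsh_type[OF X p]]]
      cmp_ident[OF Copsh_val[OF X p]] hom_refl[OF Copsh_val[OF X p]] by simp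
  have comp: "qhom (Copsh Q X) p' p'' \<odot> qhom (Copsh Q X) p p' \<preceq> qhom (Copsh Q X) p p''"
    if p: "p \<in> qob (Copsh Q X)" and p': "p' \<in> qob (Copsh Q X)" and p'': "p'' \<in> qob (Copsh Q X)"
    for p p' p''
    using le_Copsh_hom_iff[OF X p p'' cmp_in[OF P[OF p p'] P[OF p' p'']]]
      cmp_chain_right[OF Copsh_hom_action[OF X p' p''] Copsh_hom_action[OF X p p']
        Copsh_val[OF X p''] P[OF p' p''] P[OF p p'] Copsh_val[OF X p'] Copsh_val[OF X p]] by blast
  show ?thesis
    using id comp P Copsh_type[OF X] by (simp add: qcategory_iff qrel_def)
qed

lemma fst_coyon [simp]: "fst (coyon X x) = qtype X x"
  and snd_coyon [simp]: "x' \<in> qob X \<Longrightarrow> snd (coyon X x) x' = qhom X x x'"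
  by (simp_all add: coyon_def)

lemma coyon_in: "\<lbrakk>qcategory Q X; x \<in> qob X\<rbrakk> \<Longrightarrow> coyon X x \<in> qob (Copsh Q X)"
  using qhom_in[of X] qhom_trans[of X] qtype_in[of X]
  by (auto simp: Copsh_mem_iff) (simp add: coyon_def)

lemma coyoneda:
  assumes X: "qcategory Q X" and x: "x \<in> qob X" and p: "p \<in> qob (Copsh Q X)"
  shows "qhom (Copsh Q X) p (coyon X x) = snd p x"
proof (rule hom_antisym)
  note y = coyon_in[OF X x]
  let ?h = "qhom (Copsh Q X) p (coyon X x)"
  show h: "?h \<in> homs Q (fst p) (qtype X x)"
    using Copsh_hom_in[OF X p y] by simp
  show px: "snd p x \<in> homs Q (fst p) (qtype X x)"
    by (rule Copsh_val[OF X p x])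
  have "?h \<preceq> qhom X x x \<odot> ?h"
    using cmp_mono_left[OF qhom_ident[OF X x] ident_in[OF qtype_in[OF X x]] qhom_in[OF X x x] h]
      cmp_ident[OF h] by simp
  then show "?h \<preceq> snd p x"
    by (rule hom_trans)
      (use Copsh_hom_action[OF X p y x] h px cmp_in[OF h qhom_in[OF X x x]] x in simp_all)
  show "snd p x \<preceq> ?h"
    using le_Copsh_hom_iff[OF X p y, of "snd p x"] px Copsh_action[OF X p x] by simp
qed

lemma coyon_functor:
  assumes X: "qcategory Q X"
  shows "qfunctor Q X (Copsh Q X) (coyon X)"
  using coyon_in[OF X] hom_refl[OF qhom_in[OF X]] coyoneda[OF X _ coyon_in[OF X]]
  by (auto simp: qfunctor_def)

lemma fst_cop_u [simp]: "fst (cop_u Q X Y f p) = fst p"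
  by (simp add: cop_u_def case_prod_unfold)

lemma cop_u_eq:
  assumes X: "qcategory Q X" and Y: "qcategory Q Y" and f: "qfunctor Q X Y f"
    and p: "p \<in> qob (Copsh Q Y)"
  shows "cop_u Q X Y f p = (fst p, \<lambda>x \<in> qob X. snd p (f x))"
proof -
  have "rcomp Q (point Q (fst p)) Y X (ugraph Y f) (\<lambda>_ y. snd p y) (fst p) x = snd p (f x)"
    if x: "x \<in> qob X" for x
  proof -
    note fx = qfunctor_ob[OF f x] and ty = qfunctor_type[OF f x]
    note val = Copsh_val[OF Y p]
    show ?thesis
      unfolding rcomp_def
    proof (rule Sup_eqI)
      show "(\<lambda>y. ugraph Y f y x \<odot> snd p y) ` qob Y
          \<subseteq> homs Q (qtype (point Q (fst p)) (fst p)) (qtype X x)"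
        using cmp_in[OF val qhom_in[OF Y _ fx]] ty by (auto simp: ugraph_def point_def)
      show "snd p (f x) \<in> homs Q (qtype (point Q (fst p)) (fst p)) (qtype X x)"
        using val[OF fx] ty by (simp add: point_def)
      show "ugraph Y f (f x) x \<odot> snd p (f x) \<in> (\<lambda>y. ugraph Y f y x \<odot> snd p y) ` qob Y"
        using fx by blast
      show "snd p (f x) \<preceq> ugraph Y f (f x) x \<odot> snd p (f x)"
        using cmp_mono_left[OF qhom_ident[OF Y fx] ident_in[OF qtype_in[OF Y fx]]
            qhom_in[OF Y fx fx] val[OF fx]] cmp_ident[OF val[OF fx]]
        by (simp add: ugraph_def)
      show "u \<preceq> snd p (f x)" if "u \<in> (\<lambda>y. ugraph Y f y x \<odot> snd p y) ` qob Y" for u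
        using that Copsh_action[OF Y p _ fx] by (auto simp: ugraph_def)
    qed
  qed
  then show ?thesis
    by (auto simp: cop_u_def case_prod_unfold intro!: restrict_ext)
qed

lemma snd_cop_u:
  assumes "qcategory Q X" "qcategory Q Y" "qfunctor Q X Y f" "p \<in> qob (Copsh Q Y)" "x \<in> qob X"
  shows "snd (cop_u Q X Y f p) x = snd p (f x)"
  using assms by (simp add: cop_u_eq)

lemma cop_u_functor:
  assumes X: "qcategory Q X" and Y: "qcategory Q Y" and f: "qfunctor Q X Y f"
  shows "qfunctor Q (Copsh Q Y) (Copsh Q X) (cop_u Q X Y f)"
proof -
  note fo = qfunctor_ob[OF f] and ft = qfunctor_type[OF f] and fh = qfunctor_hom[OF f]
  have in_Copsh: "cop_u Q X Y f p \<in> qob (Copsh Q X)" if p: "p \<in> qob (Copsh Q Y)" for p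
  proof -
    have val: "snd p (f x) \<in> homs Q (fst p) (qtype X x)" if "x \<in> qob X" for x
      using Copsh_val[OF Y p fo] ft that by fastforce
    have "qhom X x x' \<odot> snd p (f x) \<preceq> snd p (f x')" if x: "x \<in> qob X" and x': "x' \<in> qob X" for x x'
    proof (rule hom_trans)
      have Yh: "qhom Y (f x) (f x') \<in> homs Q (qtype X x) (qtype X x')"
        using qhom_in[OF Y fo[OF x] fo[OF x']] ft x x' by simp
      show "qhom X x x' \<odot> snd p (f x) \<preceq> qhom Y (f x) (f x') \<odot> snd p (f x)"
        by (rule cmp_mono_left[OF fh[OF x x'] qhom_in[OF X x x'] Yh val[OF x]])
      show "qhom Y (f x) (f x') \<odot> snd p (f x) \<preceq> snd p (f x')"
        by (rule Copsh_action[OF Y p fo[OF x] fo[OF x']])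
      show "qhom X x x' \<odot> snd p (f x) \<in> homs Q (fst p) (qtype X x')"
        by (rule cmp_in[OF val[OF x] qhom_in[OF X x x']])
      show "qhom Y (f x) (f x') \<odot> snd p (f x) \<in> homs Q (fst p) (qtype X x')"
        by (rule cmp_in[OF val[OF x] Yh])
    qed (rule val[OF x'])
    then show ?thesis
      using val Copsh_type[OF Y p] by (simp add: Copsh_mem_iff[OF X] cop_u_eq[OF X Y f p])
  qed
  moreover have "qhom (Copsh Q Y) p p' \<preceq> qhom (Copsh Q X) (cop_u Q X Y f p) (cop_u Q X Y f p')"
    if p: "p \<in> qob (Copsh Q Y)" and p': "p' \<in> qob (Copsh Q Y)" for p p'
    using le_Copsh_hom_iff[OF X in_Copsh[OF p] in_Copsh[OF p']] Copsh_hom_in[OF Y p p']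
      Copsh_hom_action[OF Y p p' fo] snd_cop_u[OF X Y f p] snd_cop_u[OF X Y f p'] by simp
  ultimately show ?thesis by (simp add: qfunctor_def)
qed


section \<open>The double copresheaf monad\<close>

lemma qcategory_DC: "qcategory Q X \<Longrightarrow> qcategory Q (DC Q X)"
  by (simp add: DC_def qcategory_Psh qcategory_Copsh)

lemma qtype_DC [simp]: "qtype (DC Q X) = fst"
  by (simp add: DC_def)

lemma fst_dc_map [simp]: "fst (dc_map Q X Y f t) = fst t"
  by (simp add: dc_map_def cop_l_def case_prod_unfold)

text \<open>Since \<open>f\<^sub>!\<close> is left adjoint to \<open>f\<^sup>!\<close>, the lower graph of the former is the upper graph of the
  latter, and so the two decorated maps that they induce on copresheaves coincide.\<close>

lemma dc_map_eq_cop_u: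
  assumes X: "qcategory Q X" and Y: "qcategory Q Y" and f: "qfunctor Q X Y f"
  shows "dc_map Q X Y f t = cop_u Q (Psh Q Y) (Psh Q X) (psh_u Q X Y f) t"
proof -
  have "lgraph (Psh Q Y) (psh_l Q X Y f) p q = ugraph (Psh Q X) (psh_u Q X Y f) p q"
    if "p \<in> qob (Psh Q X)" "q \<in> qob (Psh Q Y)" for p q
    using psh_adjunction[OF X Y f that] by (simp add: lgraph_def ugraph_def)
  then have "(\<lambda>p. lgraph (Psh Q Y) (psh_l Q X Y f) p q \<odot> snd t p) ` qob (Psh Q X)
      = (\<lambda>p. ugraph (Psh Q X) (psh_u Q X Y f) p q \<odot> snd t p) ` qob (Psh Q X)"
    if "q \<in> qob (Psh Q Y)" for q
    using that by (intro image_cong) simp_all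
  then show ?thesis
    by (auto simp: dc_map_def cop_l_def cop_u_def rcomp_def case_prod_unfold intro!: restrict_ext)
qed

lemma dc_map_functor:
  assumes X: "qcategory Q X" and Y: "qcategory Q Y" and f: "qfunctor Q X Y f"
  shows "qfunctor Q (DC Q X) (DC Q Y) (dc_map Q X Y f)"
proof -
  have "dc_map Q X Y f = cop_u Q (Psh Q Y) (Psh Q X) (psh_u Q X Y f)"
    using dc_map_eq_cop_u[OF assms] by blast
  then show ?thesis
    using cop_u_functor[OF qcategory_Psh[OF Y] qcategory_Psh[OF X] psh_u_functor[OF assms]]
    by (simp add: DC_def)
qed

lemma dc_map_eq:
  assumes X: "qcategory Q X" and Y: "qcategory Q Y" and f: "qfunctor Q X Y f"
    and t: "t \<in> qob (DC Q X)"
  shows "dc_map Q X Y f t = (fst t, \<lambda>q \<in> qob (Psh Q Y). snd t (psh_u Q X Y f q))"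
  using dc_map_eq_cop_u[OF X Y f, of t] t
    cop_u_eq[OF qcategory_Psh[OF Y] qcategory_Psh[OF X] psh_u_functor[OF X Y f]]
  by (simp add: DC_def)

lemma psh_u_cong:
  assumes "\<And>x. x \<in> qob X \<Longrightarrow> f x = g x"
  shows "psh_u Q X Y f p = psh_u Q X Y g p"
  using assms by (auto simp: psh_u_def rcomp_def lgraph_def case_prod_unfold intro!: restrict_ext)

lemma psh_u_comp:
  assumes X: "qcategory Q X" and Y: "qcategory Q Y" and Z: "qcategory Q Z"
    and f: "qfunctor Q X Y f" and g: "qfunctor Q Y Z g" and p: "p \<in> qob (Psh Q Z)"
  shows "psh_u Q X Y f (psh_u Q Y Z g p) = psh_u Q X Z (g \<circ> f) p"
  using psh_u_eq[OF X Y f qfunctor_ob[OF psh_u_functor[OF Y Z g] p]] psh_u_eq[OF Y Z g p]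
    psh_u_eq[OF X Z qfunctor_comp[OF X Y Z f g] p] qfunctor_ob[OF f]
  by (auto intro!: restrict_ext)

lemma dc_map_comp:
  assumes X: "qcategory Q X" and Y: "qcategory Q Y" and Z: "qcategory Q Z"
    and f: "qfunctor Q X Y f" and g: "qfunctor Q Y Z g" and t: "t \<in> qob (DC Q X)"
  shows "dc_map Q Y Z g (dc_map Q X Y f t) = dc_map Q X Z (g \<circ> f) t"
  using dc_map_eq[OF Y Z g qfunctor_ob[OF dc_map_functor[OF X Y f] t]] dc_map_eq[OF X Y f t]
    dc_map_eq[OF X Z qfunctor_comp[OF X Y Z f g] t] qfunctor_ob[OF psh_u_functor[OF Y Z g]]
    psh_u_comp[OF X Y Z f g]
  by (auto intro!: restrict_ext)

lemma dc_map_cong: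
  assumes X: "qcategory Q X" and Y: "qcategory Q Y" and f: "qfunctor Q X Y f"
    and g: "qfunctor Q X Y g" and fg: "\<And>x. x \<in> qob X \<Longrightarrow> f x = g x" and t: "t \<in> qob (DC Q X)"
  shows "dc_map Q X Y f t = dc_map Q X Y g t"
  using dc_map_eq[OF X Y f t] dc_map_eq[OF X Y g t] psh_u_cong[of X f g Y] fg by simp

lemma psh_u_id:
  assumes X: "qcategory Q X" and f: "qfunctor Q X X f" and "\<And>x. x \<in> qob X \<Longrightarrow> f x = x"
    and p: "p \<in> qob (Psh Q X)"
  shows "psh_u Q X X f p = p"
proof -
  have "psh_u Q X X f p = (fst p, restrict (snd p) (qob X))"
    unfolding psh_u_eq[OF X X f p] using assms(3) by (auto intro!: restrict_ext)
  then show ?thesis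
    by (simp add: extensional_restrict[OF Psh_extensional[OF X p]])
qed

lemma dc_map_id:
  assumes X: "qcategory Q X" and f: "qfunctor Q X X f" and "\<And>x. x \<in> qob X \<Longrightarrow> f x = x"
    and t: "t \<in> qob (DC Q X)"
  shows "dc_map Q X X f t = t"
proof -
  have "dc_map Q X X f t = (fst t, restrict (snd t) (qob (Psh Q X)))"
    unfolding dc_map_eq[OF X X f t] using psh_u_id[OF X f assms(3)] by (auto intro!: restrict_ext)
  then show ?thesis
    using Copsh_extensional[OF qcategory_Psh[OF X]] t by (simp add: extensional_restrict DC_def)
qed

lemma psh_mult_functor:
  assumes X: "qcategory Q X"
  shows "qfunctor Q (Psh Q (Psh Q X)) (Psh Q X) (psh_mult Q X)"
  unfolding psh_mult_def by (rule psh_u_functor[OF X qcategory_Psh[OF X] yon_functor[OF X]])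

lemma fst_psh_mult [simp]: "fst (psh_mult Q X p) = fst p"
  by (simp add: psh_mult_def)

lemma snd_psh_mult:
  assumes X: "qcategory Q X" and p: "p \<in> qob (Psh Q (Psh Q X))" and x: "x \<in> qob X"
  shows "snd (psh_mult Q X p) x = snd p (yon X x)"
  unfolding psh_mult_def by (rule snd_psh_u[OF X qcategory_Psh[OF X] yon_functor[OF X] p x])

text \<open>A unit law of the presheaf monad. It is the reason why \<open>D y\<close> is fully faithful and has the
  retraction \<open>D s\<close>.\<close>

lemma psh_mult_yon:
  assumes X: "qcategory Q X" and p: "p \<in> qob (Psh Q X)"
  shows "psh_mult Q X (yon (Psh Q X) p) = p"
proof -
  note PX = qcategory_Psh[OF X]
  have "psh_mult Q X (yon (Psh Q X) p) = (fst p, \<lambda>x \<in> qob X. snd (yon (Psh Q X) p) (yon X x))"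
    unfolding psh_mult_def psh_u_eq[OF X PX yon_functor[OF X] yon_in[OF PX p]] by simp
  also have "\<dots> = (fst p, restrict (snd p) (qob X))"
    using yoneda[OF X _ p] yon_in[OF X] by (auto intro!: restrict_ext)
  finally show ?thesis
    by (simp add: extensional_restrict[OF Psh_extensional[OF X p]])
qed

lemma snd_dc_map_yon:
  assumes X: "qcategory Q X" and t: "t \<in> qob (DC Q X)" and p: "p \<in> qob (Psh Q (Psh Q X))"
  shows "snd (dc_map Q X (Psh Q X) (yon X) t) p = snd t (psh_mult Q X p)"
  using dc_map_eq[OF X qcategory_Psh[OF X] yon_functor[OF X] t] p by (simp add: psh_mult_def)

lemma dc_unit_functor:
  assumes X: "qcategory Q X"
  shows "qfunctor Q X (DC Q X) (dc_unit Q X)"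
  unfolding dc_unit_def DC_def
  by (rule qfunctor_comp[OF X _ _ yon_functor[OF X] coyon_functor])
    (intro qcategory_Psh qcategory_Copsh X)+

lemma snd_dc_unit:
  assumes X: "qcategory Q X" and x: "x \<in> qob X" and p: "p \<in> qob (Psh Q X)"
  shows "snd (dc_unit Q X x) p = snd p x"
  using yoneda[OF X x p] p by (simp add: dc_unit_def)

text \<open>Naturality of the unit: both sides evaluate a presheaf on \<open>Y\<close> at \<open>f x\<close>.\<close>

lemma dc_map_unit:
  assumes X: "qcategory Q X" and Y: "qcategory Q Y" and f: "qfunctor Q X Y f" and x: "x \<in> qob X"
  shows "dc_map Q X Y f (dc_unit Q X x) = dc_unit Q Y (f x)"
proof -
  note e = qfunctor_ob[OF dc_unit_functor[OF X] x]
  have "dc_map Q X Y f (dc_unit Q X x)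
      = (qtype X x, \<lambda>q \<in> qob (Psh Q Y). snd (dc_unit Q X x) (psh_u Q X Y f q))"
    unfolding dc_map_eq[OF X Y f e] by (simp add: dc_unit_def)
  also have "\<dots> = (qtype X x, \<lambda>q \<in> qob (Psh Q Y). qhom (Psh Q Y) (yon Y (f x)) q)"
    using snd_dc_unit[OF X x qfunctor_ob[OF psh_u_functor[OF X Y f]]] snd_psh_u[OF X Y f _ x]
      yoneda[OF Y qfunctor_ob[OF f x]] by (auto intro!: restrict_ext)
  finally show ?thesis
    using qfunctor_type[OF f x] by (simp add: dc_unit_def coyon_def)
qed

lemma yon_coyon_functor:
  assumes X: "qcategory Q X"
  shows "qfunctor Q (Psh Q X) (Psh Q (DC Q X)) (yon (DC Q X) \<circ> coyon (Psh Q X))"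
  unfolding DC_def
  by (rule qfunctor_comp[OF _ _ _ coyon_functor yon_functor])
    (intro qcategory_Psh qcategory_Copsh X)+

lemma dc_mult_functor:
  assumes X: "qcategory Q X"
  shows "qfunctor Q (DC Q (DC Q X)) (DC Q X) (dc_mult Q X)"
  unfolding dc_mult_def DC_def[of Q "DC Q X"]
  by (rule cop_u_functor[OF _ _ yon_coyon_functor[OF X], folded DC_def[of Q X]])
    (intro qcategory_Psh qcategory_DC X)+

lemma snd_dc_mult:
  assumes X: "qcategory Q X" and t: "t \<in> qob (DC Q (DC Q X))" and p: "p \<in> qob (Psh Q X)"
  shows "snd (dc_mult Q X t) p = snd t (yon (DC Q X) (coyon (Psh Q X) p))"
  unfolding dc_mult_def
  using snd_cop_u[OF qcategory_Psh[OF X] qcategory_Psh[OF qcategory_DC[OF X]]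
      yon_coyon_functor[OF X] _ p] t by (simp add: DC_def)

lemma fst_dc_mult [simp]: "fst (dc_mult Q X t) = fst t"
  by (simp add: dc_mult_def)

section \<open>The distributive law\<close>

lemma qfunctor_cong:
  "(\<And>x. x \<in> qob X \<Longrightarrow> f x = g x) \<Longrightarrow> qfunctor Q X Y f \<longleftrightarrow> qfunctor Q X Y g"
  by (simp add: qfunctor_def Pi_def)

lemma qle_refl: "\<lbrakk>qcategory Q X; x \<in> qob X\<rbrakk> \<Longrightarrow> qle Q X x x"
  by (simp add: qle_def qhom_ident)

lemma fst_dc_law [simp]: "fst (dc_law Q X S) = fst S"
  by (simp add: dc_law_def larrow_def)

lemma snd_dc_law: "t \<in> qob (DC Q X) \<Longrightarrow>
    snd (dc_law Q X S) t = qhom (DC Q (Psh Q X)) (dc_map Q X (Psh Q X) (yon X) t) S"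
  by (simp add: dc_law_def larrow_def lgraph_def)

lemma dc_map_yon_functor:
  "qcategory Q X \<Longrightarrow> qfunctor Q (DC Q X) (DC Q (Psh Q X)) (dc_map Q X (Psh Q X) (yon X))"
  by (intro dc_map_functor yon_functor qcategory_Psh)

lemma dc_law_eq_psh_u:
  assumes X: "qcategory Q X" and S: "S \<in> qob (DC Q (Psh Q X))"
  shows "dc_law Q X S = psh_u Q (DC Q X) (DC Q (Psh Q X)) (dc_map Q X (Psh Q X) (yon X))
    (yon (DC Q (Psh Q X)) S)"
proof -
  note g = dc_map_yon_functor[OF X] and DPX = qcategory_DC[OF qcategory_Psh[OF X]]
  show ?thesis
    unfolding psh_u_eq[OF qcategory_DC[OF X] DPX g yon_in[OF DPX S]]
    using qfunctor_ob[OF g] by (auto simp: dc_law_def larrow_def lgraph_def intro!: restrict_ext)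
qed

lemma dc_law_functor:
  assumes X: "qcategory Q X"
  shows "qfunctor Q (DC Q (Psh Q X)) (Psh Q (DC Q X)) (dc_law Q X)"
proof -
  note DX = qcategory_DC[OF X] and DPX = qcategory_DC[OF qcategory_Psh[OF X]]
  have "qfunctor Q (DC Q (Psh Q X)) (Psh Q (DC Q X))
    (psh_u Q (DC Q X) (DC Q (Psh Q X)) (dc_map Q X (Psh Q X) (yon X)) \<circ> yon (DC Q (Psh Q X)))"
    by (rule qfunctor_comp[OF DPX qcategory_Psh[OF DPX] qcategory_Psh[OF DX] yon_functor[OF DPX]
          psh_u_functor[OF DX DPX dc_map_yon_functor[OF X]]])
  moreover have "dc_law Q X S = (psh_u Q (DC Q X) (DC Q (Psh Q X))
      (dc_map Q X (Psh Q X) (yon X)) \<circ> yon (DC Q (Psh Q X))) S"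
    if "S \<in> qob (DC Q (Psh Q X))" for S
    using dc_law_eq_psh_u[OF X that] by simp
  ultimately show ?thesis
    using qfunctor_cong by blast
qed

text \<open>After transposing along the adjunction for \<open>D f\<close>, this is the action of \<open>D (f\<^sub>!)\<close> on homs,
  as \<open>D y \<circ> D f = D (y \<circ> f) = D (f\<^sub>! \<circ> y) = D (f\<^sub>!) \<circ> D y\<close>.\<close>

lemma dc_law_natural:
  assumes X: "qcategory Q X" and Y: "qcategory Q Y" and f: "qfunctor Q X Y f"
  shows "qfun_le Q (DC Q (Psh Q X)) (Psh Q (DC Q Y))
    (psh_l Q (DC Q X) (DC Q Y) (dc_map Q X Y f) \<circ> dc_law Q X)
    (dc_law Q Y \<circ> dc_map Q (Psh Q X) (Psh Q Y) (psh_l Q X Y f))"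
  unfolding qfun_le_def comp_def
proof
  fix S assume S: "S \<in> qob (DC Q (Psh Q X))"
  note PX = qcategory_Psh[OF X] and PY = qcategory_Psh[OF Y]
  note DX = qcategory_DC[OF X] and DY = qcategory_DC[OF Y]
  note Df = dc_map_functor[OF X Y f] and Pf = psh_l_functor[OF X Y f]
  note DPf = dc_map_functor[OF PX PY Pf] and yX = yon_functor[OF X] and yY = yon_functor[OF Y]
  let ?DPf = "dc_map Q (Psh Q X) (Psh Q Y) (psh_l Q X Y f)"
  have "snd (dc_law Q X S) t \<preceq> snd (dc_law Q Y (?DPf S)) (dc_map Q X Y f t)"
    if t: "t \<in> qob (DC Q X)" for t
  proof -
    have "dc_map Q Y (Psh Q Y) (yon Y) (dc_map Q X Y f t)
        = dc_map Q X (Psh Q Y) (yon Y \<circ> f) t"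
      by (rule dc_map_comp[OF X Y PY f yY t])
    also have "\<dots> = dc_map Q X (Psh Q Y) (psh_l Q X Y f \<circ> yon X) t"
      by (rule dc_map_cong[OF X PY qfunctor_comp[OF X Y PY f yY] qfunctor_comp[OF X PX PY yX Pf] _ t])
        (simp add: psh_l_yon[OF X Y f])
    also have "\<dots> = ?DPf (dc_map Q X (Psh Q X) (yon X) t)"
      by (rule dc_map_comp[OF X PX PY yX Pf t, symmetric])
    finally show ?thesis
      using qfunctor_hom[OF DPf qfunctor_ob[OF dc_map_yon_functor[OF X] t] S]
      by (simp add: snd_dc_law t qfunctor_ob[OF Df t])
  qed
  then show "qle Q (Psh Q (DC Q Y)) (psh_l Q (DC Q X) (DC Q Y) (dc_map Q X Y f) (dc_law Q X S))
      (dc_law Q Y (?DPf S))"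
    using qle_psh_l_iff[OF DX DY Df qfunctor_ob[OF dc_law_functor[OF X] S]
        qfunctor_ob[OF dc_law_functor[OF Y] qfunctor_ob[OF DPf S]]] by simp
qed

lemma DC_hom:
  assumes X: "qcategory Q X" and t: "t \<in> qob (DC Q X)" and t': "t' \<in> qob (DC Q X)"
  shows DC_hom_in: "qhom (DC Q X) t t' \<in> homs Q (fst t) (fst t')"
    and le_DC_hom_iff: "u \<in> homs Q (fst t) (fst t') \<Longrightarrow>
      u \<preceq> qhom (DC Q X) t t' \<longleftrightarrow> (\<forall>p \<in> qob (Psh Q X). snd t' p \<odot> u \<preceq> snd t p)"
    and DC_hom_action: "p \<in> qob (Psh Q X) \<Longrightarrow> snd t' p \<odot> qhom (DC Q X) t t' \<preceq> snd t p"
  using Copsh_hom_in[OF qcategory_Psh[OF X]] le_Copsh_hom_iff[OF qcategory_Psh[OF X]]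
    Copsh_hom_action[OF qcategory_Psh[OF X]] t t' by (simp_all add: DC_def)

text \<open>The copresheaf \<open>D y t\<close> is \<open>t \<circ> s\<close>, and \<open>s\<close> is onto with section \<open>y\<close>: nothing is lost by
  testing the hom only at representable arguments.\<close>

lemma dc_map_yon_fully_faithful:
  assumes X: "qcategory Q X" and t: "t \<in> qob (DC Q X)" and t': "t' \<in> qob (DC Q X)"
  shows "qhom (DC Q (Psh Q X)) (dc_map Q X (Psh Q X) (yon X) t) (dc_map Q X (Psh Q X) (yon X) t')
    = qhom (DC Q X) t t'" (is "?h = _")
proof (rule hom_antisym)
  note PX = qcategory_Psh[OF X] and g = dc_map_yon_functor[OF X]
  note gt = qfunctor_ob[OF g t] and gt' = qfunctor_ob[OF g t']
  show h: "?h \<in> homs Q (fst t) (fst t')"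
    using DC_hom_in[OF PX gt gt'] by simp
  show "qhom (DC Q X) t t' \<in> homs Q (fst t) (fst t')"
    by (rule DC_hom_in[OF X t t'])
  show "qhom (DC Q X) t t' \<preceq> ?h"
    by (rule qfunctor_hom[OF g t t'])
  have "snd t' p \<odot> ?h \<preceq> snd t p" if p: "p \<in> qob (Psh Q X)" for p
    using DC_hom_action[OF PX gt gt' yon_in[OF PX p]]
    by (simp add: snd_dc_map_yon[OF X] t t' yon_in[OF PX p] psh_mult_yon[OF X p])
  then show "?h \<preceq> qhom (DC Q X) t t'"
    using le_DC_hom_iff[OF X t t' h] by blast
qed

lemma dc_law_flat:
  assumes X: "qcategory Q X" and t: "t \<in> qob (DC Q X)"
  shows "dc_law Q X (dc_map Q X (Psh Q X) (yon X) t) = yon (DC Q X) t"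
  using dc_map_yon_fully_faithful[OF X _ t]
  by (auto simp: dc_law_def larrow_def lgraph_def yon_def intro!: restrict_ext)

text \<open>One half of the adjunction between \<open>s\<close> and \<open>y\<close> on presheaves. It lets an inequality below
  \<open>s\<close> be proved before any supremum is evaluated.\<close>

lemma psh_mult_le:
  assumes X: "qcategory Q X" and p: "p \<in> qob (Psh Q X)" and S: "S \<in> qob (Psh Q (Psh Q X))"
    and le: "qle Q (Psh Q (Psh Q X)) S (yon (Psh Q X) p)"
  shows "qle Q (Psh Q X) (psh_mult Q X S) p"
proof -
  note PX = qcategory_Psh[OF X]
  have "snd S (yon X x) \<preceq> snd p x" if x: "x \<in> qob X" for x
    using le qle_Psh_iff[OF PX S yon_in[OF PX p]] yon_in[OF X x] yoneda[OF X x p] by fastforce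
  then show ?thesis
    using le qle_Psh_iff[OF PX S yon_in[OF PX p]]
      qle_Psh_iff[OF X qfunctor_ob[OF psh_mult_functor[OF X] S] p]
    by (simp add: snd_psh_mult[OF X S])
qed

text \<open>Transposing along \<open>s\<close> and then along the lower decoration of the law leaves a comparison of
  homs, which is the action of \<open>D s\<close> (a retraction of \<open>D y\<close>) followed by the action of the law.\<close>

lemma dc_law_psh_mult:
  assumes X: "qcategory Q X"
  shows "qfun_le Q (DC Q (Psh Q (Psh Q X))) (Psh Q (DC Q X))
    (psh_mult Q (DC Q X) \<circ> psh_l Q (DC Q (Psh Q X)) (Psh Q (DC Q X)) (dc_law Q X)
      \<circ> dc_law Q (Psh Q X))
    (dc_law Q X \<circ> dc_map Q (Psh Q (Psh Q X)) (Psh Q X) (psh_mult Q X))"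
  unfolding qfun_le_def comp_def
proof
  fix T assume T: "T \<in> qob (DC Q (Psh Q (Psh Q X)))"
  note PX = qcategory_Psh[OF X] and DX = qcategory_DC[OF X]
  note PPX = qcategory_Psh[OF PX] and DPX = qcategory_DC[OF PX] and PDX = qcategory_Psh[OF DX]
  note L = dc_law_functor[OF X] and s = psh_mult_functor[OF X]
  note Ds = dc_map_functor[OF PPX PX s]
  let ?Ds = "dc_map Q (Psh Q (Psh Q X)) (Psh Q X) (psh_mult Q X)"
  let ?g = "dc_map Q (Psh Q X) (Psh Q (Psh Q X)) (yon (Psh Q X))"
  note A = qfunctor_ob[OF dc_law_functor[OF PX] T] and DsT = qfunctor_ob[OF Ds T]
  note R = qfunctor_ob[OF L DsT]
  have "snd (dc_law Q (Psh Q X) T) S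
      \<preceq> snd (yon (Psh Q (DC Q X)) (dc_law Q X (?Ds T))) (dc_law Q X S)"
    if S: "S \<in> qob (DC Q (Psh Q X))" for S
  proof -
    note gS = qfunctor_ob[OF dc_map_yon_functor[OF PX] S] and LS = qfunctor_ob[OF L S]
    have "?Ds (?g S) = dc_map Q (Psh Q X) (Psh Q X) (psh_mult Q X \<circ> yon (Psh Q X)) S"
      by (rule dc_map_comp[OF PX PPX PX yon_functor[OF PX] s S])
    also have "\<dots> = S"
      by (rule dc_map_id[OF PX qfunctor_comp[OF PX PPX PX yon_functor[OF PX] s] _ S])
        (simp add: psh_mult_yon[OF X])
    finally have "qhom (DC Q (Psh Q (Psh Q X))) (?g S) T \<preceq> qhom (DC Q (Psh Q X)) S (?Ds T)"
      using qfunctor_hom[OF Ds gS T] by simp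
    moreover note qfunctor_hom[OF L S DsT]
    ultimately have "qhom (DC Q (Psh Q (Psh Q X))) (?g S) T
        \<preceq> qhom (Psh Q (DC Q X)) (dc_law Q X S) (dc_law Q X (?Ds T))"
      by (rule hom_trans[where r = "fst S" and s = "fst T"])
        (use DC_hom_in[OF PPX gS T] DC_hom_in[OF PX S DsT] Psh_hom_in[OF DX LS R] in simp_all)
    then show ?thesis
      by (simp add: snd_dc_law S LS)
  qed
  then have "qle Q (Psh Q (Psh Q (DC Q X)))
      (psh_l Q (DC Q (Psh Q X)) (Psh Q (DC Q X)) (dc_law Q X) (dc_law Q (Psh Q X) T))
      (yon (Psh Q (DC Q X)) (dc_law Q X (?Ds T)))"
    using qle_psh_l_iff[OF DPX PDX L A yon_in[OF PDX R]] by simp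
  then show "qle Q (Psh Q (DC Q X)) (psh_mult Q (DC Q X)
      (psh_l Q (DC Q (Psh Q X)) (Psh Q (DC Q X)) (dc_law Q X) (dc_law Q (Psh Q X) T)))
      (dc_law Q X (?Ds T))"
    by (rule psh_mult_le[OF DX R psh_l_in[OF DPX PDX L A]])
qed

text \<open>Transposed, the inequality compares \<open>p x\<close>, which is the hom from \<open>y x\<close> to \<open>p\<close> by the Yoneda
  lemma, with the hom between the units at \<open>y x\<close> and \<open>p\<close>.\<close>

lemma dc_law_unit:
  assumes X: "qcategory Q X"
  shows "qfun_le Q (Psh Q X) (Psh Q (DC Q X))
    (psh_l Q X (DC Q X) (dc_unit Q X)) (dc_law Q X \<circ> dc_unit Q (Psh Q X))"
  unfolding qfun_le_def comp_def
proof
  fix p assume p: "p \<in> qob (Psh Q X)"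
  note PX = qcategory_Psh[OF X]
  note e = dc_unit_functor[OF X] and e' = dc_unit_functor[OF PX]
  have "snd p x \<preceq> snd (dc_law Q X (dc_unit Q (Psh Q X) p)) (dc_unit Q X x)"
    if x: "x \<in> qob X" for x
    using qfunctor_hom[OF e' yon_in[OF X x] p]
    by (simp add: snd_dc_law qfunctor_ob[OF e x] dc_map_unit[OF X PX yon_functor[OF X] x]
        yoneda[OF X x p])
  then show "qle Q (Psh Q (DC Q X)) (psh_l Q X (DC Q X) (dc_unit Q X) p)
      (dc_law Q X (dc_unit Q (Psh Q X) p))"
    using qle_psh_l_iff[OF X qcategory_DC[OF X] e p
        qfunctor_ob[OF dc_law_functor[OF X] qfunctor_ob[OF e' p]]] qfunctor_type[OF e' p] by simp
qed

text \<open>By the dual Yoneda lemma both presheaves send \<open>t\<close> to its value at \<open>s S\<close>.\<close>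

lemma dc_law_coyon:
  assumes X: "qcategory Q X" and S: "S \<in> qob (Psh Q (Psh Q X))"
  shows "dc_law Q X (coyon (Psh Q (Psh Q X)) S)
    = yon (DC Q X) (coyon (Psh Q X) (psh_mult Q X S))"
proof -
  note PX = qcategory_Psh[OF X] and g = dc_map_yon_functor[OF X]
  note sS = qfunctor_ob[OF psh_mult_functor[OF X] S]
  have "qhom (DC Q (Psh Q X)) (dc_map Q X (Psh Q X) (yon X) t) (coyon (Psh Q (Psh Q X)) S)
      = qhom (DC Q X) t (coyon (Psh Q X) (psh_mult Q X S))" if t: "t \<in> qob (DC Q X)" for t
    using coyoneda[OF qcategory_Psh[OF PX] S] qfunctor_ob[OF g t] coyoneda[OF PX sS] t
      snd_dc_map_yon[OF X t S] by (simp add: DC_def)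
  then show ?thesis
    by (auto simp: dc_law_def larrow_def lgraph_def yon_def intro!: restrict_ext)
qed

lemma Copsh_mono:
  assumes X: "qcategory Q X" and t: "t \<in> qob (Copsh Q X)"
    and x: "x \<in> qob X" and x': "x' \<in> qob X" and le: "qle Q X x x'"
  shows "snd t x \<preceq> snd t x'"
proof -
  have ty: "qtype X x' = qtype X x"
    using le unfolding qle_def by simp
  have id: "ident Q (qtype X x) \<preceq> qhom X x x'"
    using le unfolding qle_def by blast
  note v = Copsh_val[OF X t x] and v' = Copsh_val[OF X t x', unfolded ty]
  note Xh = qhom_in[OF X x x', unfolded ty]
  have "snd t x \<preceq> qhom X x x' \<odot> snd t x"
    using cmp_mono_left[OF id ident_in[OF qtype_in[OF X x]] Xh v] cmp_ident[OF v] by simp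
  then show ?thesis
    by (rule hom_trans[OF _ Copsh_action[OF X t x x'] v cmp_in[OF v Xh] v'])
qed

text \<open>Transposed, the inequality goes from a hom \<open>h\<close> of copresheaves on \<open>P P D X\<close> to a hom of
  copresheaves on \<open>P P X\<close>. The latter is an infimum over \<open>S \<in> P P X\<close>, and
  the constraint that \<open>h\<close> satisfies at one well-chosen presheaf yields the constraint at \<open>S\<close>.\<close>

lemma dc_law_mult:
  assumes X: "qcategory Q X"
  shows "qfun_le Q (DC Q (DC Q (Psh Q X))) (Psh Q (DC Q X))
    (psh_l Q (DC Q (DC Q X)) (DC Q X) (dc_mult Q X) \<circ> dc_law Q (DC Q X)
      \<circ> dc_map Q (DC Q (Psh Q X)) (Psh Q (DC Q X)) (dc_law Q X))
    (dc_law Q X \<circ> dc_mult Q (Psh Q X))"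
  unfolding qfun_le_def comp_def
proof
  fix T assume T: "T \<in> qob (DC Q (DC Q (Psh Q X)))"
  note PX = qcategory_Psh[OF X] and DX = qcategory_DC[OF X]
  note PPX = qcategory_Psh[OF PX] and DPX = qcategory_DC[OF PX] and PDX = qcategory_Psh[OF DX]
  note L = dc_law_functor[OF X] and m = dc_mult_functor[OF X] and m' = dc_mult_functor[OF PX]
  note DL = dc_map_functor[OF DPX PDX L]
  let ?L = "dc_law Q X"
  let ?DL = "dc_map Q (DC Q (Psh Q X)) (Psh Q (DC Q X)) ?L"
  let ?g = "dc_map Q X (Psh Q X) (yon X)"
  let ?g' = "dc_map Q (DC Q X) (Psh Q (DC Q X)) (yon (DC Q X))"
  note DLT = qfunctor_ob[OF DL T] and mT = qfunctor_ob[OF m' T]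
  have "snd (dc_law Q (DC Q X) (?DL T)) R \<preceq> snd (?L (dc_mult Q (Psh Q X) T)) (dc_mult Q X R)"
    if R: "R \<in> qob (DC Q (DC Q X))" for R
  proof -
    note g'R = qfunctor_ob[OF dc_map_yon_functor[OF DX] R] and mR = qfunctor_ob[OF m R]
    note gmR = qfunctor_ob[OF dc_map_yon_functor[OF X] mR]
    let ?h = "qhom (DC Q (Psh Q (DC Q X))) (?g' R) (?DL T)"
    have h: "?h \<in> homs Q (fst R) (fst T)"
      using DC_hom_in[OF PDX g'R DLT] by simp
    have "snd (dc_mult Q (Psh Q X) T) S \<odot> ?h \<preceq> snd (?g (dc_mult Q X R)) S"
      if S: "S \<in> qob (Psh Q (Psh Q X))" for S
    proof -
      let ?c = "coyon (Psh Q (Psh Q X)) S"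
      \<comment> \<open>The test presheaf: the image of the representable of \<open>?c\<close> under the lower decoration of the
        law, which is again representable.\<close>
      let ?F = "yon (Psh Q (DC Q X)) (?L ?c)"
      have c: "?c \<in> qob (DC Q (Psh Q X))"
        using coyon_in[OF PPX S] by (simp add: DC_def)
      note Lc = qfunctor_ob[OF L c]
      note F = yon_in[OF PDX Lc] and yc = yon_in[OF DPX c]
      note uF = qfunctor_ob[OF psh_u_functor[OF DPX PDX L] F]
      have T': "T \<in> qob (Copsh Q (Psh Q (DC Q (Psh Q X))))"
        using T by (simp add: DC_def)
      note PDPX = qcategory_Psh[OF DPX]
      have "qle Q (Psh Q (DC Q (Psh Q X))) (yon (DC Q (Psh Q X)) ?c)
          (psh_u Q (DC Q (Psh Q X)) (Psh Q (DC Q X)) ?L ?F)"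
        unfolding qle_Psh_iff[OF DPX yc uF]
        using qfunctor_hom[OF L _ c] qfunctor_ob[OF L] by (simp add: snd_psh_u[OF DPX PDX L F])
      then have "snd T (yon (DC Q (Psh Q X)) ?c)
          \<preceq> snd T (psh_u Q (DC Q (Psh Q X)) (Psh Q (DC Q X)) ?L ?F)"
        by (rule Copsh_mono[OF PDPX T' yc uF])
      then have le: "snd (dc_mult Q (Psh Q X) T) S \<preceq> snd (?DL T) ?F"
        using snd_dc_mult[OF PX T S] dc_map_eq[OF DPX PDX L T] F by simp
      have v: "snd (dc_mult Q (Psh Q X) T) S \<in> homs Q (fst T) (fst S)"
        using Copsh_val[OF PPX _ S, of "dc_mult Q (Psh Q X) T"] mT by (simp add: DC_def)
      have v': "snd (?DL T) ?F \<in> homs Q (fst T) (fst S)"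
        using Copsh_val[OF qcategory_Psh[OF PDX] _ F, of "?DL T"] DLT by (simp add: DC_def)
      have w: "snd (?g (dc_mult Q X R)) S \<in> homs Q (fst R) (fst S)"
        using Copsh_val[OF PPX _ S, of "?g (dc_mult Q X R)"] gmR by (simp add: DC_def)
      have "snd (?g' R) ?F = snd R (?L ?c)"
        using snd_dc_map_yon[OF DX R F] psh_mult_yon[OF DX Lc] by simp
      also have "\<dots> = snd (?g (dc_mult Q X R)) S"
        using snd_dc_map_yon[OF X mR S] dc_law_coyon[OF X S]
          snd_dc_mult[OF X R qfunctor_ob[OF psh_mult_functor[OF X] S]] by simp
      finally have "snd (?DL T) ?F \<odot> ?h \<preceq> snd (?g (dc_mult Q X R)) S"
        using DC_hom_action[OF PDX g'R DLT F] by simp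
      then show ?thesis
        by (rule hom_trans[OF cmp_mono_left[OF le v v' h] _ cmp_in[OF h v] cmp_in[OF h v'] w])
    qed
    then have "?h \<preceq> qhom (DC Q (Psh Q X)) (?g (dc_mult Q X R)) (dc_mult Q (Psh Q X) T)"
      using le_DC_hom_iff[OF PX gmR mT, of ?h] h by simp
    then show ?thesis
      by (simp add: snd_dc_law R mR)
  qed
  then show "qle Q (Psh Q (DC Q X))
      (psh_l Q (DC Q (DC Q X)) (DC Q X) (dc_mult Q X) (dc_law Q (DC Q X) (?DL T)))
      (?L (dc_mult Q (Psh Q X) T))"
    using qle_psh_l_iff[OF qcategory_DC[OF DX] DX m
        qfunctor_ob[OF dc_law_functor[OF DX] DLT] qfunctor_ob[OF L mT]] by simp
qed

end

theorem proposition7p1: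
  fixes Q :: "('o, 'm) quantaloid_data"
    and X :: "('a, 'o, 'm) qcat_data"
  assumes "quantaloid Q" and "qcategory Q X"
  shows "(\<forall>\<Xi> \<in> qob (DC Q (Psh Q X)).
        dc_law Q X \<Xi> =
          (psh_u Q (DC Q X) (DC Q (Psh Q X)) (dc_map Q X (Psh Q X) (yon X))
            \<circ> yon (DC Q (Psh Q X))) \<Xi> \<and>
        dc_law Q X \<Xi> =
          (psh_u Q (DC Q X) (DC Q (Psh Q X))
              (cop_u Q (Psh Q (Psh Q X)) (Psh Q X) (psh_u Q X (Psh Q X) (yon X)))
            \<circ> yon (DC Q (Psh Q X))) \<Xi>)
    \<and> qfunctor Q (DC Q (Psh Q X)) (Psh Q (DC Q X)) (dc_law Q X)
    \<and> (\<forall>(Y :: ('b, 'o, 'm) qcat_data) f. qcategory Q Y \<longrightarrow> qfunctor Q X Y f \<longrightarrow>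
        qfun_le Q (DC Q (Psh Q X)) (Psh Q (DC Q Y))
          (psh_l Q (DC Q X) (DC Q Y) (dc_map Q X Y f) \<circ> dc_law Q X)
          (dc_law Q Y \<circ> dc_map Q (Psh Q X) (Psh Q Y) (psh_l Q X Y f)))
    \<and> qfun_le Q (DC Q X) (Psh Q (DC Q X))
        (yon (DC Q X))
        (dc_law Q X \<circ> dc_map Q X (Psh Q X) (yon X))
    \<and> qfun_le Q (DC Q (Psh Q (Psh Q X))) (Psh Q (DC Q X))
        (psh_mult Q (DC Q X)
          \<circ> psh_l Q (DC Q (Psh Q X)) (Psh Q (DC Q X)) (dc_law Q X)
          \<circ> dc_law Q (Psh Q X))
        (dc_law Q X \<circ> dc_map Q (Psh Q (Psh Q X)) (Psh Q X) (psh_mult Q X))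
    \<and> qfun_le Q (Psh Q X) (Psh Q (DC Q X))
        (psh_l Q X (DC Q X) (dc_unit Q X))
        (dc_law Q X \<circ> dc_unit Q (Psh Q X))
    \<and> qfun_le Q (DC Q (DC Q (Psh Q X))) (Psh Q (DC Q X))
        (psh_l Q (DC Q (DC Q X)) (DC Q X) (dc_mult Q X)
          \<circ> dc_law Q (DC Q X)
          \<circ> dc_map Q (DC Q (Psh Q X)) (Psh Q (DC Q X)) (dc_law Q X))
        (dc_law Q X \<circ> dc_mult Q (Psh Q X))
    \<and> (\<forall>\<tau> \<in> qob (DC Q X).
        (dc_law Q X \<circ> dc_map Q X (Psh Q X) (yon X)) \<tau> = yon (DC Q X) \<tau>)"
proof -
  interpret quantaloid Q by fact
  note X = \<open>qcategory Q X\<close>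
  note PX = qcategory_Psh[OF X]
  have "dc_map Q X (Psh Q X) (yon X)
      = cop_u Q (Psh Q (Psh Q X)) (Psh Q X) (psh_u Q X (Psh Q X) (yon X))"
    using dc_map_eq_cop_u[OF X PX yon_functor[OF X]] by blast
  then have graph: "\<forall>\<Xi> \<in> qob (DC Q (Psh Q X)).
      dc_law Q X \<Xi> =
        (psh_u Q (DC Q X) (DC Q (Psh Q X)) (dc_map Q X (Psh Q X) (yon X))
          \<circ> yon (DC Q (Psh Q X))) \<Xi> \<and>
      dc_law Q X \<Xi> =
        (psh_u Q (DC Q X) (DC Q (Psh Q X))
            (cop_u Q (Psh Q (Psh Q X)) (Psh Q X) (psh_u Q X (Psh Q X) (yon X)))
          \<circ> yon (DC Q (Psh Q X))) \<Xi>"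
    using dc_law_eq_psh_u[OF X] by simp
  have flat: "\<forall>\<tau> \<in> qob (DC Q X).
      (dc_law Q X \<circ> dc_map Q X (Psh Q X) (yon X)) \<tau> = yon (DC Q X) \<tau>"
    using dc_law_flat[OF X] by simp
  then have lax: "qfun_le Q (DC Q X) (Psh Q (DC Q X)) (yon (DC Q X))
      (dc_law Q X \<circ> dc_map Q X (Psh Q X) (yon X))"
    using qle_refl[OF qcategory_Psh yon_in, OF qcategory_DC qcategory_DC, OF X X]
    unfolding qfun_le_def by simp
  show ?thesis
    by (intro conjI allI impI graph flat lax dc_law_functor[OF X] dc_law_natural[OF X]
        dc_law_psh_mult[OF X] dc_law_unit[OF X] dc_law_mult[OF X])
qed

end
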